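(* Let $\sigma_E^2=b\,\sigma_A^2$ for a fixed constant $b\in(0,\infty)$. Then, as $|\rho|\to1$ and $\sigma_A^2\to0$, $$I(\hat R_A;\hat R_E)-\Big[\tfrac12\log_2\!\Big(\frac{p}{p(1-|\rho|^2)+\sigma_A^2+\sigma_E^2}\Big)-\chi\Big]\longrightarrow0,\qquad \chi=\tfrac12\log_2\!\Big(\frac{4\pi}{e^{1+\gamma}}\Big)\approx0.69,$$ where $\gamma$ is the Euler–Mascheroni constant. The same holds for $I(\hat R_B;\hat R_E)$ with $A$ replaced by $B$, under $\sigma_E^2=b'\sigma_B^2$ for a fixed $b'\in(0,\infty)$.
   Context: Fix $p>0$, $\rho\in\mathbb C$ with $|\rho|<1$, and $\sigma_A^2,\sigma_B^2,\sigma_E^2>0$. Let $(H,H_E)$ be a zero-mean circularly-symmetric complex Gaussian (ZMCSCG) vector with covariance $p\begin{pmatrix}1&\rho\\ \bar\rho&1\end{pmatrix}$; let $W_A,W_B,W_E$ be ZMCSCG with variances $\sigma_A^2,\sigma_B^2,\sigma_E^2$, mutually independent and independent of $(H,H_E)$. Define $\hat H_A=H+W_A$, $\hat H_B=H+W_B$, $\hat H_E=H_E+W_E$ and envelopes $\hat R_X=|\hat H_X|$ for $X\in\{A,B,E\}$. Mutual information is in bits; $e$ is Euler's number. *)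

theory Defs
  imports "HOL-Probability.Probability"
begin

definition cgauss :: "real \<Rightarrow> complex measure" where
  "cgauss v = density lborel (\<lambda>z. ennreal (exp (- (cmod z)\<^sup>2 / v) / (pi * v)))"

(* ZMCSCG vector (z1,z2) with covariance p*[[1, rho],[cnj rho, 1]], i.e. density
  exp(- z^H K^{-1} z) / (pi^2 det K) with K = that covariance matrix, written out explicitly:
  det K = p^2 (1-|rho|^2) and
  z^H K^{-1} z = (|z1|^2 + |z2|^2 - 2 Re(rho * cnj z1 * z2)) / (p (1-|rho|^2)). *)
definition cgauss2 :: "real \<Rightarrow> complex \<Rightarrow> (complex \<times> complex) measure" where
  "cgauss2 p \<rho> = density lborel (\<lambda>(z1, z2). ennreal
     (exp (- ((cmod z1)\<^sup>2 + (cmod z2)\<^sup>2 - 2 * Re (\<rho> * cnj z1 * z2)) / (p * (1 - (cmod \<rho>)\<^sup>2)))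
      / (pi\<^sup>2 * p\<^sup>2 * (1 - (cmod \<rho>)\<^sup>2))))"

definition channel_model ::
  "'a measure \<Rightarrow> real \<Rightarrow> complex \<Rightarrow> real \<Rightarrow> real \<Rightarrow> real \<Rightarrow>
   ('a \<Rightarrow> complex) \<Rightarrow> ('a \<Rightarrow> complex) \<Rightarrow> ('a \<Rightarrow> complex) \<Rightarrow> ('a \<Rightarrow> complex) \<Rightarrow> ('a \<Rightarrow> complex) \<Rightarrow> bool"
  where
  "channel_model M p \<rho> sA sB sE H HE WA WB WE \<longleftrightarrow>
     prob_space M \<and>
     (let T = cgauss2 p \<rho> \<Otimes>\<^sub>M (cgauss sA \<Otimes>\<^sub>M (cgauss sB \<Otimes>\<^sub>M cgauss sE));
          X = (\<lambda>\<omega>. ((H \<omega>, HE \<omega>), (WA \<omega>, (WB \<omega>, WE \<omega>))))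
      in X \<in> measurable M T \<and> distr M T X = T)"

definition MI_bits :: "'a measure \<Rightarrow> ('a \<Rightarrow> real) \<Rightarrow> ('a \<Rightarrow> real) \<Rightarrow> real" where
  "MI_bits M X Y = prob_space.mutual_information M 2 borel borel X Y"

definition chi_const :: real where
  "chi_const = 1/2 * log 2 (4 * pi / exp (1 + euler_mascheroni))"

end

theory Submission
  imports Defs "HOL-Real_Asymp.Real_Asymp"
begin

text \<open>
  The pair \<open>(H + W\<^sub>A, H\<^sub>E + W\<^sub>E)\<close> is again jointly complex Gaussian; only its squared correlation
  \<open>r\<^sup>2 = p\<^sup>2 |\<rho>|\<^sup>2 / ((p + \<sigma>\<^sub>A\<^sup>2) (p + \<sigma>\<^sub>E\<^sup>2))\<close> matters. The normalised envelopes are distributed like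
  \<open>x = |Z|\<close> and \<open>y = |r |Z| + s N|\<close> with \<open>Z, N\<close> independent standard Gaussians and \<open>s\<^sup>2 = 1 - r\<^sup>2\<close>,
  and their joint law has density
  \<open>exp (- r\<^sup>2 (x\<^sup>2 + y\<^sup>2) / s\<^sup>2) I\<^sub>0 (2 r x y / s\<^sup>2) / s\<^sup>2\<close> with respect to the product of the marginals.
  Writing \<open>ln I\<^sub>0 t = t - ln (2 \<pi> t) / 2 + h t\<close>, the logarithm of this density is
  \<open>- ln s\<^sup>2 / 2 - ln (4 \<pi> r) / 2 - r (x - y)\<^sup>2 / s\<^sup>2 + r (x\<^sup>2 + y\<^sup>2) / (1 + r) + h (2 r x y / s\<^sup>2) - ln (x y) / 2\<close>.
  As \<open>r\<close> tends to 1, \<open>(x - y)\<^sup>2 / s\<^sup>2\<close> has mean tending to \<open>E (Re N)\<^sup>2 = 1/2\<close> by dominated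
  convergence, \<open>E ln x = E ln y = - \<gamma> / 2\<close>, and the \<open>h\<close>-term vanishes because
  \<open>|h t| \<le> \<epsilon> + C\<^sub>\<epsilon> / sqrt t\<close> and \<open>E (1 / x) < \<infinity>\<close>.
\<close>

section \<open>Lebesgue measure on the complex plane\<close>

text \<open>The limit is singular: at r = 1 the joint law of the envelopes has no density with
  respect to the product of its marginals, so the divergent term must be split off exactly.
  Realising both envelopes on one fixed Gaussian pair (Z, N) makes this possible: only the integrand
  depends on r, and since y is Rayleigh for every r, terms in x alone or in y alone have computable
  means. Only the squared difference and the Bessel remainder couple x and y. The first is dominated
  by 2 |Z|^2 + 2 |N|^2 for all r; the second is decoupled by 1 / sqrt (x y) <= (1 / x + 1 / y) / 2.
  The two-parameter limit in rho and the noise becomes the limit r -> 1 because ln (1 - r^2) differs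
  from - ln (p / D), where D = p (1 - |rho|^2) + sigma_A^2 + sigma_E^2, by at most (sigma_A^2 +
  sigma_E^2) / p, uniformly in rho. Hence the two rates may be unrelated.\<close>

lemma measurable_Complex [measurable (raw)]:
  assumes [measurable]: "f \<in> borel_measurable M" "g \<in> borel_measurable M"
  shows "(\<lambda>x. Complex (f x) (g x)) \<in> borel_measurable M"
  unfolding Complex_eq by measurable

text \<open>Lebesgue measure is determined by its values on boxes, and a complex box pulls back to a
  product of two intervals.\<close>

lemma lborel_complex_eq:
  "(lborel :: complex measure) = distr (lborel \<Otimes>\<^sub>M lborel) borel (\<lambda>(x, y). Complex x y)"
proof (rule lborel_eqI)
  fix l u :: complex
  assume le: "\<And>b. b \<in> Basis \<Longrightarrow> l \<bullet> b \<le> u \<bullet> b"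
  have "(\<lambda>(x, y). Complex x y) -` box l u = {Re l<..<Re u} \<times> {Im l<..<Im u}"
    by (auto simp: in_box_complex_iff)
  moreover have "Re l \<le> Re u" "Im l \<le> Im u"
    using le[of 1] le[of \<i>] by (auto simp: Basis_complex_def inner_complex_def)
  ultimately show "emeasure (distr (lborel \<Otimes>\<^sub>M lborel) borel (\<lambda>(x, y). Complex x y)) (box l u)
      = (\<Prod>b\<in>Basis. (u - l) \<bullet> b)"
    by (subst emeasure_distr)
       (auto simp: space_pair_measure lborel.emeasure_pair_measure_Times Basis_complex_def
          inner_complex_def ennreal_mult)
qed simp

lemma nn_integral_lborel_complex:
  assumes [measurable]: "F \<in> borel_measurable borel"
  shows "(\<integral>\<^sup>+z. F z \<partial>lborel) = (\<integral>\<^sup>+x. \<integral>\<^sup>+y. F (Complex x y) \<partial>lborel \<partial>lborel)"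
proof -
  show ?thesis
    by (subst lborel_complex_eq, subst nn_integral_distr)
       (auto simp: lborel.nn_integral_fst[symmetric])
qed

lemma nn_integral_lborel_plus_right:
  fixes f :: "real \<Rightarrow> ennreal"
  assumes "f \<in> borel_measurable borel"
  shows "(\<integral>\<^sup>+x. f (x + t) \<partial>lborel) = (\<integral>\<^sup>+x. f x \<partial>lborel)"
  using nn_integral_real_affine[OF assms, of 1 t] by (simp add: add.commute)

text \<open>For a fixed imaginary part the shear is a translation of the real part, so it suffices
  to make the real part the inner variable.\<close>

lemma nn_integral_shear_Re:
  assumes F[measurable]: "F \<in> borel_measurable borel"
  shows "(\<integral>\<^sup>+z. F (Complex (Re z + t * Im z) (Im z)) \<partial>lborel) = (\<integral>\<^sup>+z. F z \<partial>lborel)"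
proof -
  have "(\<integral>\<^sup>+z. F (Complex (Re z + t * Im z) (Im z)) \<partial>lborel)
      = (\<integral>\<^sup>+x. \<integral>\<^sup>+y. F (Complex (x + t * y) y) \<partial>lborel \<partial>lborel)"
    by (subst nn_integral_lborel_complex) auto
  also have "\<dots> = (\<integral>\<^sup>+y. \<integral>\<^sup>+x. F (Complex (x + t * y) y) \<partial>lborel \<partial>lborel)"
    by (rule lborel_pair.Fubini') simp
  also have "\<dots> = (\<integral>\<^sup>+y. \<integral>\<^sup>+x. F (Complex x y) \<partial>lborel \<partial>lborel)"
    by (intro nn_integral_cong nn_integral_lborel_plus_right[where f = "\<lambda>x. F (Complex x _)"])
       simp
  also have "\<dots> = (\<integral>\<^sup>+x. \<integral>\<^sup>+y. F (Complex x y) \<partial>lborel \<partial>lborel)"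
    by (rule lborel_pair.Fubini') simp
  also have "\<dots> = (\<integral>\<^sup>+z. F z \<partial>lborel)"
    by (subst nn_integral_lborel_complex) auto
  finally show ?thesis .
qed

lemma nn_integral_shear_Im:
  assumes F[measurable]: "F \<in> borel_measurable borel"
  shows "(\<integral>\<^sup>+z. F (Complex (Re z) (Im z + t * Re z)) \<partial>lborel) = (\<integral>\<^sup>+z. F z \<partial>lborel)"
proof -
  have "(\<integral>\<^sup>+z. F (Complex (Re z) (Im z + t * Re z)) \<partial>lborel)
      = (\<integral>\<^sup>+x. \<integral>\<^sup>+y. F (Complex x (y + t * x)) \<partial>lborel \<partial>lborel)"
    by (subst nn_integral_lborel_complex) auto
  also have "\<dots> = (\<integral>\<^sup>+x. \<integral>\<^sup>+y. F (Complex x y) \<partial>lborel \<partial>lborel)"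
    by (intro nn_integral_cong nn_integral_lborel_plus_right[where f = "\<lambda>y. F (Complex _ y)"])
       simp
  also have "\<dots> = (\<integral>\<^sup>+z. F z \<partial>lborel)"
    by (subst nn_integral_lborel_complex) auto
  finally show ?thesis .
qed

text \<open>A rotation with non-real multiplier is a product of three shears.\<close>

lemma nn_integral_lborel_rotate_aux:
  assumes u: "cmod u = 1" "Im u \<noteq> 0" and F[measurable]: "F \<in> borel_measurable borel"
  shows "(\<integral>\<^sup>+z. F (u * z) \<partial>lborel) = (\<integral>\<^sup>+z. F z \<partial>lborel)"
proof -
  \<comment> \<open>For \<open>u = cis a\<close> this is \<open>- tan (a / 2)\<close>, the shear
    factor in the classical decomposition of a rotation into three shears.\<close>
  define t where "t = (Re u - 1) / Im u"
  define S where "S z = Complex (Re z + t * Im z) (Im z)" for z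
  define S' where "S' z = Complex (Re z) (Im z + Im u * Re z)" for z
  have [measurable]: "S \<in> borel_measurable borel" "S' \<in> borel_measurable borel"
    unfolding S_def S'_def by measurable
  have tu: "t * Im u = Re u - 1" and uu: "(Re u)\<^sup>2 + (Im u)\<^sup>2 = 1"
    using u by (auto simp: t_def cmod_power2[symmetric])
  have t2: "t * (1 + Re u) = - Im u"
    using u(2) uu unfolding t_def by (simp add: field_simps power2_eq_square)
  have eq: "u * z = S (S' (S z))" for z
  proof (rule complex_eqI)
    have "Re (S (S' (S z))) = (1 + t * Im u) * Re z + t * (1 + (1 + t * Im u)) * Im z"
      by (simp add: S_def S'_def algebra_simps)
    then show "Re (u * z) = Re (S (S' (S z)))"
      by (simp add: tu t2)
    have "Im (S (S' (S z))) = Im u * Re z + (1 + t * Im u) * Im z"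
      by (simp add: S_def S'_def algebra_simps)
    then show "Im (u * z) = Im (S (S' (S z)))"
      by (simp add: tu)
  qed
  have "(\<integral>\<^sup>+z. F (u * z) \<partial>lborel) = (\<integral>\<^sup>+z. (\<lambda>z. F (S (S' z))) (S z) \<partial>lborel)"
    by (simp add: eq)
  also have "\<dots> = (\<integral>\<^sup>+z. (\<lambda>z. F (S z)) (S' z) \<partial>lborel)"
    unfolding S_def[of "_ :: complex", abs_def]
    by (rule nn_integral_shear_Re) (simp add: S_def[symmetric])
  also have "\<dots> = (\<integral>\<^sup>+z. F (S z) \<partial>lborel)"
    unfolding S'_def by (rule nn_integral_shear_Im) simp
  also have "\<dots> = (\<integral>\<^sup>+z. F z \<partial>lborel)"
    unfolding S_def by (rule nn_integral_shear_Re) simp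
  finally show ?thesis .
qed

lemma nn_integral_lborel_rotate:
  assumes u: "cmod u = 1" and F[measurable]: "F \<in> borel_measurable borel"
  shows "(\<integral>\<^sup>+z. F (u * z) \<partial>lborel) = (\<integral>\<^sup>+z. F z \<partial>lborel)"
proof (cases "Im u = 0")
  case False
  then show ?thesis using nn_integral_lborel_rotate_aux[OF u _ F] by simp
next
  case True
  \<comment> \<open>Now \<open>u\<close> is 1 or -1, where the shear factor is undefined;
    \<open>u\<close> is therefore split into two rotations with non-real multipliers.\<close>
  then have u_eq: "\<i> * (- \<i> * u) = u" and "cmod (-\<i> * u) = 1" "Im (- \<i> * u) \<noteq> 0"
    using u by (auto simp: norm_mult cmod_eq_Re)
  have "(\<integral>\<^sup>+z. F (u * z) \<partial>lborel) = (\<integral>\<^sup>+z. (\<lambda>z. F (\<i> * z)) (- \<i> * u * z) \<partial>lborel)"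
    by (simp add: mult.assoc[symmetric])
  also have "\<dots> = (\<integral>\<^sup>+z. F (\<i> * z) \<partial>lborel)"
    using \<open>cmod (-\<i> * u) = 1\<close> \<open>Im (- \<i> * u) \<noteq> 0\<close> by (intro nn_integral_lborel_rotate_aux) auto
  also have "\<dots> = (\<integral>\<^sup>+z. F z \<partial>lborel)"
    by (rule nn_integral_lborel_rotate_aux) auto
  finally show ?thesis .
qed

lemma nn_integral_complex_affine:
  fixes c :: real and F :: "complex \<Rightarrow> ennreal"
  assumes [measurable]: "F \<in> borel_measurable borel" and c: "c \<noteq> 0"
  shows "(\<integral>\<^sup>+z. F z \<partial>lborel) = ennreal (c\<^sup>2) * (\<integral>\<^sup>+z. F (t + of_real c * z) \<partial>lborel)"
  by (subst lborel_affine[OF c, of t])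
     (simp add: nn_integral_density nn_integral_distr nn_integral_cmult scaleR_conv_of_real)

text \<open>The area of a disc is linear in its squared radius, so the image of planar Lebesgue
  measure under the squared modulus is \<open>pi\<close> times Lebesgue measure on the
  half-line.\<close>

lemma nn_integral_cmod_sq:
  assumes [measurable]: "f \<in> borel_measurable borel"
  shows "(\<integral>\<^sup>+z. f ((cmod z)\<^sup>2) \<partial>lborel) = ennreal pi * (\<integral>\<^sup>+u. f u * indicator {0..} u \<partial>lborel)"
proof -
  \<comment> \<open>The sign turns discs into preimages of upper rays, the sets on which
    \<open>measure_eqI_lessThan\<close> compares measures; these preimages have finite area.\<close>
  let ?M = "distr (lborel :: complex measure) borel (\<lambda>z. - (cmod z)\<^sup>2)"
  let ?N = "density lborel (\<lambda>u. ennreal pi * indicator {..0} u)"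
  have M: "emeasure ?M {x<..} = ennreal (pi * max 0 (- x))" for x
  proof -
    have "emeasure ?M {x<..} = emeasure lborel (ball (0::complex) (sqrt (max 0 (- x))))"
    proof (subst emeasure_distr)
      have "(\<lambda>z. - (cmod z)\<^sup>2) -` {x<..} = ball 0 (sqrt (max 0 (- x)))"
        by (auto simp: real_less_rsqrt real_sqrt_less_iff max_def sqrt_le_D not_le
              intro!: real_less_rsqrt)
          (smt (verit) real_sqrt_less_iff norm_ge_zero real_sqrt_abs zero_le_power2 abs_of_nonneg)+
      then show "emeasure lborel ((\<lambda>z. - (cmod z)\<^sup>2) -` {x<..} \<inter> space lborel)
          = emeasure lborel (ball (0::complex) (sqrt (max 0 (- x))))"
        by simp
    qed auto
    also have "\<dots> = ennreal (pi * max 0 (- x))"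
      by (subst emeasure_ball) (auto simp: unit_ball_vol_numeral eval_unit_ball_vol)
    finally show ?thesis .
  qed
  have "?M = ?N"
  proof (rule measure_eqI_lessThan)
    fix x :: real
    show "emeasure ?M {x<..} < \<infinity>"
      unfolding M by simp
    have "emeasure ?N {x<..} = (\<integral>\<^sup>+u. ennreal pi * indicator {x<..0} u \<partial>lborel)"
      by (subst emeasure_density) (auto intro!: nn_integral_cong split: split_indicator)
    also have "\<dots> = ennreal (pi * max 0 (- x))"
      by (subst nn_integral_cmult_indicator) (auto simp: ennreal_mult max_def not_le)
    finally show "emeasure ?M {x<..} = emeasure ?N {x<..}"
      unfolding M by simp
  qed auto
  then have "(\<integral>\<^sup>+u. f (- u) \<partial>?M) = (\<integral>\<^sup>+u. f (- u) \<partial>?N)"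
    by simp
  also have "(\<integral>\<^sup>+u. f (- u) \<partial>?M) = (\<integral>\<^sup>+z. f ((cmod z)\<^sup>2) \<partial>lborel)"
    by (subst nn_integral_distr) auto
  also have "(\<integral>\<^sup>+u. f (- u) \<partial>?N) = ennreal pi * (\<integral>\<^sup>+u. f (- u) * indicator {..0} u \<partial>lborel)"
    by (subst nn_integral_density)
       (auto simp: nn_integral_cmult[symmetric] intro!: nn_integral_cong split: split_indicator)
  also have "(\<integral>\<^sup>+u. f (- u) * indicator {..0} u \<partial>lborel) = (\<integral>\<^sup>+u. f u * indicator {0..} u \<partial>lborel)"
    using nn_integral_real_affine[of "\<lambda>u. f u * indicator {0..} u" "-1" 0]
    by (auto intro!: nn_integral_cong split: split_indicator)
  finally show ?thesis .
qed

section \<open>Complex Gaussian measures\<close>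

definition cgauss_density :: "real \<Rightarrow> complex \<Rightarrow> real" where
  "cgauss_density v z = exp (- (cmod z)\<^sup>2 / v) / (pi * v)"

lemma cgauss_density_nonneg: "v > 0 \<Longrightarrow> 0 \<le> cgauss_density v z"
  by (simp add: cgauss_density_def)

lemma measurable_cgauss_density [measurable]: "cgauss_density v \<in> borel_measurable borel"
  unfolding cgauss_density_def by measurable

lemma cgauss_eq_density: "cgauss v = density lborel (\<lambda>z. ennreal (cgauss_density v z))"
  by (simp add: cgauss_def cgauss_density_def)

lemma sets_cgauss [simp, measurable_cong]: "sets (cgauss v) = sets borel"
  by (simp add: cgauss_eq_density)

lemma space_cgauss [simp]: "space (cgauss v) = UNIV"
  by (simp add: cgauss_eq_density)

lemma nn_integral_cgauss:
  assumes "f \<in> borel_measurable borel"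
  shows "(\<integral>\<^sup>+z. f z \<partial>cgauss v) = (\<integral>\<^sup>+z. ennreal (cgauss_density v z) * f z \<partial>lborel)"
  unfolding cgauss_eq_density using assms by (subst nn_integral_density) auto

text \<open>Source of the normalisation of \<open>cgauss\<close> and of all radial moments: the disc
  constant \<open>pi\<close> cancels the one in the density and leaves an exponential law.\<close>

lemma nn_integral_cgauss_cmod_sq:
  assumes v: "v > 0" and [measurable]: "f \<in> borel_measurable borel"
  shows "(\<integral>\<^sup>+z. f ((cmod z)\<^sup>2) \<partial>cgauss v) = (\<integral>\<^sup>+u. ennreal (exponential_density (1 / v) u) * f u \<partial>lborel)"
proof -
  have "(\<integral>\<^sup>+z. f ((cmod z)\<^sup>2) \<partial>cgauss v)
      = ennreal pi * (\<integral>\<^sup>+u. ennreal (exp (- u / v) / (pi * v)) * f u * indicator {0..} u \<partial>lborel)"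
    using nn_integral_cmod_sq[of "\<lambda>u. ennreal (exp (- u / v) / (pi * v)) * f u"]
    by (simp add: nn_integral_cgauss cgauss_density_def)
  also have "\<dots> = (\<integral>\<^sup>+u. ennreal (exponential_density (1 / v) u) * f u \<partial>lborel)"
  proof (subst nn_integral_cmult[symmetric], simp, intro nn_integral_cong)
    fix u :: real
    have "ennreal pi * ennreal (exp (- u / v) / (pi * v)) = ennreal (exp (- u / v) / v)"
      using v by (subst ennreal_mult[symmetric]) auto
    then show "ennreal pi * (ennreal (exp (- u / v) / (pi * v)) * f u * indicator {0..} u)
        = ennreal (exponential_density (1 / v) u) * f u"
      by (auto simp: exponential_density_def mult.assoc[symmetric] split: split_indicator)
  qed
  finally show ?thesis .
qed

lemma prob_space_cgauss:
  assumes "v > 0"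
  shows "prob_space (cgauss v)"
proof
  interpret E: prob_space "density lborel (exponential_density (1 / v))"
    by (rule prob_space_exponential_density) (use assms in simp)
  have "emeasure (cgauss v) (space (cgauss v)) = (\<integral>\<^sup>+z. (\<lambda>_. 1) ((cmod z)\<^sup>2) \<partial>cgauss v)"
    by simp
  also have "\<dots> = (\<integral>\<^sup>+u. ennreal (exponential_density (1 / v) u) \<partial>lborel)"
    using assms by (subst nn_integral_cgauss_cmod_sq) auto
  also have "\<dots> = 1"
    using E.emeasure_space_1 by (simp add: emeasure_density)
  finally show "emeasure (cgauss v) (space (cgauss v)) = 1" .
qed

lemma nn_integral_cgauss_shift:
  assumes [measurable]: "f \<in> borel_measurable borel"
  shows "(\<integral>\<^sup>+n. f (q + n) \<partial>cgauss v) = (\<integral>\<^sup>+w. ennreal (cgauss_density v (w - q)) * f w \<partial>lborel)"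
  using nn_integral_complex_affine[of "\<lambda>w. ennreal (cgauss_density v (w - q)) * f w" 1 q]
  by (simp add: nn_integral_cgauss)

lemma nn_integral_cgauss_scale:
  assumes v: "v > 0" and [measurable]: "f \<in> borel_measurable borel"
  shows "(\<integral>\<^sup>+z. f z \<partial>cgauss v) = (\<integral>\<^sup>+z. f (of_real (sqrt v) * z) \<partial>cgauss 1)"
proof -
  have "(\<integral>\<^sup>+z. f z \<partial>cgauss v)
      = (\<integral>\<^sup>+z. ennreal v * (ennreal (cgauss_density v (of_real (sqrt v) * z)) * f (of_real (sqrt v) * z)) \<partial>lborel)"
    using nn_integral_complex_affine[of "\<lambda>w. ennreal (cgauss_density v w) * f w" "sqrt v" 0] v
    by (simp add: nn_integral_cgauss nn_integral_cmult)
  also have "\<dots> = (\<integral>\<^sup>+z. f (of_real (sqrt v) * z) \<partial>cgauss 1)"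
    using v by (auto simp: nn_integral_cgauss mult.assoc[symmetric] ennreal_mult'[symmetric]
        cgauss_density_def norm_mult power_mult_distrib intro!: nn_integral_cong)
  finally show ?thesis .
qed

lemma nn_integral_cgauss_rotate:
  assumes u: "cmod u = 1" and [measurable]: "f \<in> borel_measurable borel"
  shows "(\<integral>\<^sup>+z. f (u * z) \<partial>cgauss v) = (\<integral>\<^sup>+z. f z \<partial>cgauss v)"
  using nn_integral_lborel_rotate[OF u, of "\<lambda>w. ennreal (cgauss_density v w) * f w"] u
  by (simp add: nn_integral_cgauss cgauss_density_def norm_mult)

text \<open>Bayes' rule for Gaussians: if \<open>e\<close> and \<open>n\<close> are independent, then \<open>e\<close> is a multiple of
  \<open>x = \<rho> * e + n\<close> plus Gaussian noise independent of \<open>x\<close>.\<close>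

lemma cgauss_density_swap:
  fixes p u :: real and \<rho> :: complex
  assumes "p > 0" "u > 0"
  defines "t \<equiv> p * (cmod \<rho>)\<^sup>2 + u"
  shows "cgauss_density p e * cgauss_density u (x - \<rho> * e)
       = cgauss_density t x * cgauss_density (p * u / t) (e - of_real (p / t) * cnj \<rho> * x)"
proof -
  have t: "t > 0" using assms by (simp add: add_nonneg_pos)
  define X where "X = Re (\<rho> * cnj x * e)"
  have 1: "(cmod (x - \<rho> * e))\<^sup>2 = (cmod x)\<^sup>2 + (cmod \<rho>)\<^sup>2 * (cmod e)\<^sup>2 - 2 * X"
    unfolding X_def by (simp only: cmod_power2) (simp add: algebra_simps power2_eq_square)
  have 2: "(cmod (e - of_real k * cnj \<rho> * x))\<^sup>2
      = (cmod e)\<^sup>2 + k\<^sup>2 * (cmod \<rho>)\<^sup>2 * (cmod x)\<^sup>2 - 2 * k * X" for k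
    unfolding X_def by (simp only: cmod_power2) (simp add: algebra_simps power2_eq_square)
  \<comment> \<open>Both exponents are linear in \<open>B\<close>, \<open>C\<close> and
    \<open>X\<close>, so what remains is a rational identity: completing the square in
    \<open>e\<close>, with \<open>t = p * A + u\<close>.\<close>
  define A B C where "A = (cmod \<rho>)\<^sup>2" and "B = (cmod e)\<^sup>2" and "C = (cmod x)\<^sup>2"
  have "- B / p + - (C + A * B - 2 * X) / u
      = - C / t + - (B + (p / t)\<^sup>2 * A * C - 2 * (p / t) * X) / (p * u / t)"
  proof -
    have "- C / t + - (B + (p / t)\<^sup>2 * A * C - 2 * (p / t) * X) / (p * u / t)
      = - B * (t / (p * u)) - C * ((u + p * A) / (u * t)) + 2 * X / u"
      using assms(1,2) t by (simp add: divide_simps power2_eq_square) (simp add: algebra_simps)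
    also have "\<dots> = - B * ((p * A + u) / (p * u)) - C / u + 2 * X / u"
      using t by (simp add: t_def A_def add.commute)
    also have "\<dots> = - B / p + - (C + A * B - 2 * X) / u"
      using assms(1,2) by (simp add: divide_simps) (simp add: algebra_simps)
    finally show ?thesis by simp
  qed
  then have "- (cmod e)\<^sup>2 / p + - (cmod (x - \<rho> * e))\<^sup>2 / u
     = - (cmod x)\<^sup>2 / t + - (cmod (e - of_real (p / t) * cnj \<rho> * x))\<^sup>2 / (p * u / t)"
    unfolding 1 2 A_def B_def C_def by simp
  then have "exp (- (cmod e)\<^sup>2 / p) * exp (- (cmod (x - \<rho> * e))\<^sup>2 / u)
     = exp (- (cmod x)\<^sup>2 / t) * exp (- (cmod (e - of_real (p / t) * cnj \<rho> * x))\<^sup>2 / (p * u / t))"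
    by (simp only: exp_add[symmetric])
  then show ?thesis
    using t by (simp add: cgauss_density_def divide_simps)
qed

text \<open>Integrated form of \<open>cgauss_density_swap\<close>. The factor
  \<open>p / t * cnj \<rho>\<close> is the regression coefficient of \<open>e\<close> on
  \<open>x\<close>, and \<open>p * u / t\<close> is the residual variance.\<close>

lemma nn_integral_cgauss_swap:
  fixes p u :: real and \<rho> :: complex
  assumes p: "p > 0" and u: "u > 0" and \<phi>[measurable]: "\<phi> \<in> borel_measurable (borel \<Otimes>\<^sub>M borel)"
  defines "t \<equiv> p * (cmod \<rho>)\<^sup>2 + u"
  shows "(\<integral>\<^sup>+e. \<integral>\<^sup>+n. \<phi> (\<rho> * e + n, e) \<partial>cgauss u \<partial>cgauss p)
       = (\<integral>\<^sup>+x. \<integral>\<^sup>+n. \<phi> (x, of_real (p / t) * cnj \<rho> * x + n) \<partial>cgauss (p * u / t) \<partial>cgauss t)"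
proof -
  have t: "t > 0" using p u by (simp add: t_def add_nonneg_pos)
  interpret U: prob_space "cgauss u" by (rule prob_space_cgauss[OF u])
  interpret V: prob_space "cgauss (p * u / t)" by (rule prob_space_cgauss) (use p u t in simp)
  have "(\<integral>\<^sup>+e. \<integral>\<^sup>+n. \<phi> (\<rho> * e + n, e) \<partial>cgauss u \<partial>cgauss p)
      = (\<integral>\<^sup>+e. \<integral>\<^sup>+x. ennreal (cgauss_density p e) * (ennreal (cgauss_density u (x - \<rho> * e)) * \<phi> (x, e)) \<partial>lborel \<partial>lborel)"
    by (simp add: nn_integral_cgauss_shift[where f = "\<lambda>x. \<phi> (x, _)"] nn_integral_cgauss nn_integral_cmult)
  also have "\<dots> = (\<integral>\<^sup>+x. \<integral>\<^sup>+e. ennreal (cgauss_density p e) * (ennreal (cgauss_density u (x - \<rho> * e)) * \<phi> (x, e)) \<partial>lborel \<partial>lborel)"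
    by (rule lborel_pair.Fubini') simp
  also have "\<dots> = (\<integral>\<^sup>+x. \<integral>\<^sup>+e. ennreal (cgauss_density t x) * (ennreal (cgauss_density (p * u / t) (e - of_real (p / t) * cnj \<rho> * x)) * \<phi> (x, e)) \<partial>lborel \<partial>lborel)"
    using cgauss_density_swap[OF p u, of _ _ \<rho>] p u t
    by (simp add: mult.assoc[symmetric] ennreal_mult[symmetric] cgauss_density_nonneg t_def)
  also have "\<dots> = (\<integral>\<^sup>+x. \<integral>\<^sup>+n. \<phi> (x, of_real (p / t) * cnj \<rho> * x + n) \<partial>cgauss (p * u / t) \<partial>cgauss t)"
    by (simp add: nn_integral_cgauss_shift[where f = "\<lambda>e. \<phi> (_, e)"] nn_integral_cgauss nn_integral_cmult)
  finally show ?thesis .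
qed

text \<open>The swap with multiplier 1 and an integrand that ignores \<open>e\<close>: the residual
  noise integrates to 1 and the law of the sum is left.\<close>

lemma nn_integral_cgauss_add:
  assumes p: "p > 0" and u: "u > 0" and f[measurable]: "f \<in> borel_measurable borel"
  shows "(\<integral>\<^sup>+e. \<integral>\<^sup>+n. f (e + n) \<partial>cgauss u \<partial>cgauss p) = (\<integral>\<^sup>+x. f x \<partial>cgauss (p + u))"
proof -
  interpret V: prob_space "cgauss (p * u / (p + u))" by (rule prob_space_cgauss) (use p u in simp)
  show ?thesis
    using nn_integral_cgauss_swap[OF p u, of "\<lambda>z. f (fst z)" 1] by (simp add: V.emeasure_space_1[simplified])
qed

section \<open>The Rician law\<close>

text \<open>The integrand has period \<open>2 * pi\<close>: the part of the shifted window that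
  leaves on the right re-enters on the left. The bounds on \<open>\<phi>\<close> keep the cut points
  in order.\<close>

lemma nn_integral_cos_shift:
  fixes f :: "real \<Rightarrow> ennreal"
  assumes [measurable]: "f \<in> borel_measurable borel" and \<phi>: "0 \<le> \<phi>" "\<phi> < 2 * pi"
  shows "(\<integral>\<^sup>+\<theta>. f (cos (\<theta> + \<phi>)) * indicator {-pi..<pi} \<theta> \<partial>lborel)
       = (\<integral>\<^sup>+\<theta>. f (cos \<theta>) * indicator {-pi..<pi} \<theta> \<partial>lborel)"
proof -
  let ?g = "\<lambda>\<theta>. f (cos \<theta>)"
  have "(\<integral>\<^sup>+\<theta>. f (cos (\<theta> + \<phi>)) * indicator {-pi..<pi} \<theta> \<partial>lborel)
      = (\<integral>\<^sup>+\<theta>. (\<lambda>\<theta>. ?g \<theta> * indicator {-pi + \<phi>..<pi + \<phi>} \<theta>) (\<theta> + \<phi>) \<partial>lborel)"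
    by (intro nn_integral_cong) (auto split: split_indicator)
  also have "\<dots> = (\<integral>\<^sup>+\<theta>. ?g \<theta> * indicator {-pi + \<phi>..<pi + \<phi>} \<theta> \<partial>lborel)"
    by (rule nn_integral_lborel_plus_right) simp
  also have "\<dots> = (\<integral>\<^sup>+\<theta>. ?g \<theta> * indicator {-pi + \<phi>..<pi} \<theta> + ?g \<theta> * indicator {pi..<pi + \<phi>} \<theta> \<partial>lborel)"
    using \<phi> by (intro nn_integral_cong) (auto split: split_indicator)
  also have "\<dots> = (\<integral>\<^sup>+\<theta>. ?g \<theta> * indicator {-pi + \<phi>..<pi} \<theta> \<partial>lborel)
      + (\<integral>\<^sup>+\<theta>. ?g \<theta> * indicator {pi..<pi + \<phi>} \<theta> \<partial>lborel)"
    by (rule nn_integral_add) auto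
  also have "(\<integral>\<^sup>+\<theta>. ?g \<theta> * indicator {pi..<pi + \<phi>} \<theta> \<partial>lborel)
      = (\<integral>\<^sup>+\<theta>. (\<lambda>\<theta>. ?g \<theta> * indicator {pi..<pi + \<phi>} \<theta>) (\<theta> + 2 * pi) \<partial>lborel)"
    by (rule nn_integral_lborel_plus_right[symmetric]) simp
  also have "\<dots> = (\<integral>\<^sup>+\<theta>. ?g \<theta> * indicator {-pi..<-pi + \<phi>} \<theta> \<partial>lborel)"
    by (intro nn_integral_cong) (auto split: split_indicator)
  also have "(\<integral>\<^sup>+\<theta>. ?g \<theta> * indicator {-pi + \<phi>..<pi} \<theta> \<partial>lborel)
      + (\<integral>\<^sup>+\<theta>. ?g \<theta> * indicator {-pi..<-pi + \<phi>} \<theta> \<partial>lborel)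
      = (\<integral>\<^sup>+\<theta>. ?g \<theta> * indicator {-pi + \<phi>..<pi} \<theta> + ?g \<theta> * indicator {-pi..<-pi + \<phi>} \<theta> \<partial>lborel)"
    by (rule nn_integral_add[symmetric]) auto
  also have "\<dots> = (\<integral>\<^sup>+\<theta>. ?g \<theta> * indicator {-pi..<pi} \<theta> \<partial>lborel)"
    using \<phi> by (intro nn_integral_cong) (auto split: split_indicator)
  finally show ?thesis .
qed

text \<open>The modified Bessel function of the first kind and order 0, by its integral over one
  period. With a half-open interval translated periods fit together without overlap.\<close>

definition bessel_I0 :: "real \<Rightarrow> real" where
  "bessel_I0 x = (\<integral>\<theta>. exp (x * cos \<theta>) * indicator {-pi..<pi} \<theta> \<partial>lborel) / (2 * pi)"

lemma integrable_bessel_I0: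
  "integrable lborel (\<lambda>\<theta>. exp (x * cos \<theta>) * indicator {-pi..<pi} \<theta>)"
proof (rule Bochner_Integration.integrable_bound)
  show "integrable lborel (\<lambda>\<theta>. exp \<bar>x\<bar> * indicator {-pi..<pi} \<theta> :: real)"
    by simp
  have "x * cos \<theta> \<le> \<bar>x\<bar>" for \<theta>
    using mult_left_mono[OF abs_cos_le_one[of \<theta>], of "\<bar>x\<bar>"] by (simp add: abs_mult[symmetric])
  then show "AE \<theta> in lborel. norm (exp (x * cos \<theta>) * indicator {-pi..<pi} \<theta>) \<le> norm (exp \<bar>x\<bar> * indicator {-pi..<pi} \<theta> :: real)"
    by (auto split: split_indicator)
qed simp

lemma nn_integral_bessel_I0:
  "(\<integral>\<^sup>+\<theta>. ennreal (exp (x * cos \<theta>)) * indicator {-pi..<pi} \<theta> \<partial>lborel) = ennreal (2 * pi * bessel_I0 x)"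
proof -
  have "(\<integral>\<^sup>+\<theta>. ennreal (exp (x * cos \<theta>)) * indicator {-pi..<pi} \<theta> \<partial>lborel)
      = (\<integral>\<^sup>+\<theta>. ennreal (exp (x * cos \<theta>) * indicator {-pi..<pi} \<theta>) \<partial>lborel)"
    by (intro nn_integral_cong) (auto split: split_indicator)
  also have "\<dots> = ennreal (\<integral>\<theta>. exp (x * cos \<theta>) * indicator {-pi..<pi} \<theta> \<partial>lborel)"
    by (rule nn_integral_eq_integral[OF integrable_bessel_I0]) auto
  finally show ?thesis by (simp add: bessel_I0_def)
qed

text \<open>This crude bound and its upper companion control the logarithm of
  \<open>bessel_I0\<close> on bounded ranges, where the asymptotics at infinity give nothing; this
  one also yields positivity.\<close>

lemma bessel_I0_ge: "bessel_I0 x \<ge> exp (- \<bar>x\<bar>)"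
proof -
  have "- \<bar>x\<bar> \<le> x * cos \<theta>" for \<theta>
    using mult_left_mono[OF abs_cos_le_one[of \<theta>], of "\<bar>x\<bar>"] by (simp add: abs_mult[symmetric])
  then have "(\<integral>\<theta>. exp (- \<bar>x\<bar>) * indicator {-pi..<pi} \<theta> \<partial>lborel)
      \<le> (\<integral>\<theta>. exp (x * cos \<theta>) * indicator {-pi..<pi} \<theta> \<partial>lborel)"
    by (intro integral_mono integrable_bessel_I0) (auto split: split_indicator)
  then show ?thesis by (simp add: bessel_I0_def field_simps)
qed

lemma bessel_I0_le: "bessel_I0 x \<le> exp \<bar>x\<bar>"
proof -
  have "x * cos \<theta> \<le> \<bar>x\<bar>" for \<theta>
    using mult_left_mono[OF abs_cos_le_one[of \<theta>], of "\<bar>x\<bar>"] by (simp add: abs_mult[symmetric])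
  then have "(\<integral>\<theta>. exp (x * cos \<theta>) * indicator {-pi..<pi} \<theta> \<partial>lborel)
      \<le> (\<integral>\<theta>. exp \<bar>x\<bar> * indicator {-pi..<pi} \<theta> \<partial>lborel)"
    by (intro integral_mono integrable_bessel_I0) (auto split: split_indicator)
  then show ?thesis by (simp add: bessel_I0_def field_simps)
qed

lemma bessel_I0_pos: "bessel_I0 x > 0"
  by (rule less_le_trans[OF _ bessel_I0_ge]) simp

lemma measurable_bessel_I0 [measurable]: "bessel_I0 \<in> borel_measurable borel"
  unfolding bessel_I0_def by measurable

text \<open>In polar form the argument of \<open>z\<close> becomes a shift of the angle;
  \<open>Arg2pi\<close> takes its values in the range that \<open>nn_integral_cos_shift\<close>
  demands.\<close>

lemma nn_integral_rotations:
  "(\<integral>\<^sup>+\<theta>. ennreal (exp (Re (z * cis \<theta>))) * indicator {-pi..<pi} \<theta> \<partial>lborel)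
     = ennreal (2 * pi * bessel_I0 (cmod z))"
proof -
  have "Re (z * cis \<theta>) = cmod z * cos (\<theta> + Arg2pi z)" for \<theta>
  proof -
    have "z = of_real (cmod z) * cis (Arg2pi z)"
      using Arg2pi_eq[of z] by (simp add: cis_conv_exp mult.commute)
    then have "z * cis \<theta> = of_real (cmod z) * cis (\<theta> + Arg2pi z)"
      by (metis cis_mult mult.assoc mult.commute)
    then show ?thesis by simp
  qed
  then show ?thesis
    using nn_integral_cos_shift[of "\<lambda>c. ennreal (exp (cmod z * c))" "Arg2pi z"] Arg2pi[of z]
    by (simp add: nn_integral_bessel_I0)
qed

text \<open>The Rician law: averaging over rotations makes the density a function of the modulus alone,
  which replaces polar coordinates.\<close>

lemma nn_integral_rician:
  assumes v: "v > 0" and \<psi>[measurable]: "\<psi> \<in> borel_measurable borel"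
  shows "(\<integral>\<^sup>+n. \<psi> (cmod (q + n)) \<partial>cgauss v)
    = (\<integral>\<^sup>+w. ennreal (exp (- (cmod q)\<^sup>2 / v) * bessel_I0 (2 * cmod q * cmod w / v)) * \<psi> (cmod w) \<partial>cgauss v)"
    (is "?L = ?R")
proof -
  interpret prob_space "cgauss v" by (rule prob_space_cgauss[OF v])
  define K where "K = exp (- (cmod q)\<^sup>2 / v)"
  define E where "E w = ennreal (exp (Re (2 / of_real v * cnj q * w)))" for w
  have [measurable]: "E \<in> borel_measurable borel" unfolding E_def by measurable
  have dens: "cgauss_density v (w - q) = cgauss_density v w * (K * exp (Re (2 / of_real v * cnj q * w)))" for w
  proof -
    have "(cmod (w - q))\<^sup>2 = (cmod w)\<^sup>2 + (cmod q)\<^sup>2 - 2 * Re (cnj q * w)"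
      by (simp only: cmod_power2) (simp add: algebra_simps power2_eq_square)
    moreover have "Re (2 / of_real v * cnj q * w) = 2 * Re (cnj q * w) / v"
      by (simp add: Re_divide_of_real)
    ultimately have "- (cmod (w - q))\<^sup>2 / v
        = - (cmod w)\<^sup>2 / v + (- (cmod q)\<^sup>2 / v + Re (2 / of_real v * cnj q * w))"
      by (simp add: diff_divide_distrib add_divide_distrib)
    then show ?thesis
      unfolding cgauss_density_def K_def by (simp only: exp_add) simp
  qed
  have L: "?L = (\<integral>\<^sup>+w. ennreal K * E w * \<psi> (cmod w) \<partial>cgauss v)"
    unfolding E_def using v
    by (subst nn_integral_cgauss_shift[where f = "\<lambda>w. \<psi> (cmod w)"], simp, subst nn_integral_cgauss)
       (auto simp: dens K_def ennreal_mult cgauss_density_nonneg mult_ac intro!: nn_integral_cong)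
  have Lt: "?L = (\<integral>\<^sup>+w. ennreal K * E (cis \<theta> * w) * \<psi> (cmod w) \<partial>cgauss v)" for \<theta>
    using nn_integral_cgauss_rotate[of "cis \<theta>" "\<lambda>w. ennreal K * E w * \<psi> (cmod w)" v]
    by (simp add: L norm_mult)
  \<comment> \<open>By \<open>Lt\<close> the integral has the same value for every rotation angle,
    so it may be averaged over a period. After the exchange of integrals only \<open>E\<close>
    depends on the angle, and its average is a Bessel value.\<close>
  have "ennreal (2 * pi) * ?L = (\<integral>\<^sup>+\<theta>. ?L * indicator {-pi..<pi} \<theta> \<partial>lborel)"
    by (subst nn_integral_cmult_indicator) (auto simp: mult.commute)
  also have "\<dots> = (\<integral>\<^sup>+\<theta>. \<integral>\<^sup>+w. ennreal K * E (cis \<theta> * w) * \<psi> (cmod w) * indicator {-pi..<pi} \<theta> \<partial>cgauss v \<partial>lborel)"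
    by (intro nn_integral_cong, subst Lt) (simp add: nn_integral_multc)
  also have "\<dots> = (\<integral>\<^sup>+w. \<integral>\<^sup>+\<theta>. ennreal K * E (cis \<theta> * w) * \<psi> (cmod w) * indicator {-pi..<pi} \<theta> \<partial>lborel \<partial>cgauss v)"
  proof -
    interpret pair_sigma_finite lborel "cgauss v" ..
    have [measurable]: "cis \<in> borel_measurable borel"
      by (intro borel_measurable_continuous_onI continuous_intros)
    show ?thesis by (rule Fubini'[symmetric]) simp
  qed
  also have "\<dots> = (\<integral>\<^sup>+w. ennreal K * \<psi> (cmod w) * ennreal (2 * pi * bessel_I0 (2 * cmod q * cmod w / v)) \<partial>cgauss v)"
  proof (intro nn_integral_cong)
    fix w
    have [measurable]: "cis \<in> borel_measurable borel"
      by (intro borel_measurable_continuous_onI continuous_intros)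
    have "(\<integral>\<^sup>+\<theta>. ennreal K * E (cis \<theta> * w) * \<psi> (cmod w) * indicator {-pi..<pi} \<theta> \<partial>lborel)
        = (\<integral>\<^sup>+\<theta>. ennreal K * \<psi> (cmod w) * (ennreal (exp (Re ((2 / of_real v * cnj q * w) * cis \<theta>))) * indicator {-pi..<pi} \<theta>) \<partial>lborel)"
      by (intro nn_integral_cong) (simp add: E_def mult_ac)
    also have "\<dots> = ennreal K * \<psi> (cmod w) * ennreal (2 * pi * bessel_I0 (cmod (2 / of_real v * cnj q * w)))"
      by (subst nn_integral_cmult, simp, subst nn_integral_rotations, rule refl)
    also have "cmod (2 / of_real v * cnj q * w) = 2 * cmod q * cmod w / v"
      using v by (simp add: norm_mult norm_divide)
    finally show "(\<integral>\<^sup>+\<theta>. ennreal K * E (cis \<theta> * w) * \<psi> (cmod w) * indicator {-pi..<pi} \<theta> \<partial>lborel)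
      = ennreal K * \<psi> (cmod w) * ennreal (2 * pi * bessel_I0 (2 * cmod q * cmod w / v))" .
  qed
  also have "\<dots> = (\<integral>\<^sup>+w. ennreal (2 * pi) * (ennreal (K * bessel_I0 (2 * cmod q * cmod w / v)) * \<psi> (cmod w)) \<partial>cgauss v)"
    using bessel_I0_pos by (intro nn_integral_cong) (simp add: ennreal_mult less_imp_le K_def mult_ac)
  also have "\<dots> = ennreal (2 * pi) * ?R"
    unfolding K_def by (rule nn_integral_cmult) simp
  finally show ?thesis
    by (simp add: ennreal_mult_cancel_left)
qed

text \<open>The Rician density sees the centre only through its modulus. This is how the phases of
  \<open>\<rho>\<close> and of the first observation disappear.\<close>

lemma nn_integral_rician_cong:
  assumes "v > 0" "\<psi> \<in> borel_measurable borel" "cmod q = cmod q'"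
  shows "(\<integral>\<^sup>+n. \<psi> (cmod (q + n)) \<partial>cgauss v) = (\<integral>\<^sup>+n. \<psi> (cmod (q' + n)) \<partial>cgauss v)"
  using assms by (simp add: nn_integral_rician)

section \<open>Correlated envelopes\<close>

text \<open>Completing the square in the quadratic form splits the joint density into the marginal
  of the second coordinate and the conditional law of the first, with mean \<open>\<rho> * e\<close>
  and variance \<open>v\<close>.\<close>

lemma nn_integral_cgauss2:
  fixes p :: real and \<rho> :: complex
  assumes p: "p > 0" and \<rho>: "cmod \<rho> < 1" and \<phi>[measurable]: "\<phi> \<in> borel_measurable (borel \<Otimes>\<^sub>M borel)"
  defines "v \<equiv> p * (1 - (cmod \<rho>)\<^sup>2)"
  shows "(\<integral>\<^sup>+z. \<phi> z \<partial>cgauss2 p \<rho>) = (\<integral>\<^sup>+e. \<integral>\<^sup>+n. \<phi> (\<rho> * e + n, e) \<partial>cgauss v \<partial>cgauss p)"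
proof -
  have \<rho>2: "(cmod \<rho>)\<^sup>2 < 1"
    using \<rho> by (simp add: power_less_one_iff)
  then have v: "v > 0" using p by (simp add: v_def)
  interpret V: prob_space "cgauss v" by (rule prob_space_cgauss[OF v])
  have dens: "exp (- ((cmod z1)\<^sup>2 + (cmod z2)\<^sup>2 - 2 * Re (\<rho> * cnj z1 * z2)) / v) / (pi\<^sup>2 * p\<^sup>2 * (1 - (cmod \<rho>)\<^sup>2))
      = cgauss_density p z2 * cgauss_density v (z1 - \<rho> * z2)" for z1 z2
  proof -
    have 1: "(cmod (z1 - \<rho> * z2))\<^sup>2 = (cmod z1)\<^sup>2 + (cmod \<rho>)\<^sup>2 * (cmod z2)\<^sup>2 - 2 * Re (\<rho> * cnj z1 * z2)"
      by (simp only: cmod_power2) (simp add: algebra_simps power2_eq_square)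
    have "- (cmod z2)\<^sup>2 / p = - ((1 - (cmod \<rho>)\<^sup>2) * (cmod z2)\<^sup>2) / v"
      using \<rho>2 p by (simp add: v_def)
    then have "- ((cmod z1)\<^sup>2 + (cmod z2)\<^sup>2 - 2 * Re (\<rho> * cnj z1 * z2)) / v
        = - (cmod z2)\<^sup>2 / p + - (cmod (z1 - \<rho> * z2))\<^sup>2 / v"
      unfolding 1 by (simp add: add_divide_distrib[symmetric] diff_divide_distrib[symmetric] algebra_simps)
    then show ?thesis
      unfolding cgauss_density_def by (simp only: exp_add) (simp add: v_def power2_eq_square mult_ac)
  qed
  have "(\<integral>\<^sup>+z. \<phi> z \<partial>cgauss2 p \<rho>)
     = (\<integral>\<^sup>+z. ennreal (cgauss_density p (snd z) * cgauss_density v (fst z - \<rho> * snd z)) * \<phi> z \<partial>(lborel \<Otimes>\<^sub>M lborel))"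
    unfolding cgauss2_def v_def[symmetric] case_prod_beta dens lborel_prod[symmetric]
    by (subst nn_integral_density) auto
  also have "\<dots> = (\<integral>\<^sup>+e. \<integral>\<^sup>+x. ennreal (cgauss_density p e * cgauss_density v (x - \<rho> * e)) * \<phi> (x, e) \<partial>lborel \<partial>lborel)"
    by (subst lborel_pair.nn_integral_snd[symmetric]) auto
  also have "\<dots> = (\<integral>\<^sup>+e. \<integral>\<^sup>+x. ennreal (cgauss_density p e) * (ennreal (cgauss_density v (x - \<rho> * e)) * \<phi> (x, e)) \<partial>lborel \<partial>lborel)"
    using p v by (simp add: ennreal_mult cgauss_density_nonneg mult.assoc)
  also have "\<dots> = (\<integral>\<^sup>+e. \<integral>\<^sup>+n. \<phi> (\<rho> * e + n, e) \<partial>cgauss v \<partial>cgauss p)"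
    by (simp add: nn_integral_cgauss_shift[where f = "\<lambda>x. \<phi> (x, _)"] nn_integral_cgauss nn_integral_cmult)
  finally show ?thesis .
qed

lemma sets_cgauss2 [simp, measurable_cong]: "sets (cgauss2 p \<rho>) = sets (borel \<Otimes>\<^sub>M borel)"
  unfolding cgauss2_def by (simp only: sets_density sets_lborel borel_prod)

lemma space_cgauss2 [simp]: "space (cgauss2 p \<rho>) = UNIV"
  by (simp add: cgauss2_def)

lemma prob_space_cgauss2:
  assumes p: "p > 0" and \<rho>: "cmod \<rho> < 1"
  shows "prob_space (cgauss2 p \<rho>)"
proof
  have "(cmod \<rho>)\<^sup>2 < 1" using \<rho> by (simp add: power_less_one_iff)
  then interpret V: prob_space "cgauss (p * (1 - (cmod \<rho>)\<^sup>2))"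
    using p by (intro prob_space_cgauss) simp
  interpret P: prob_space "cgauss p" by (rule prob_space_cgauss[OF p])
  show "emeasure (cgauss2 p \<rho>) (space (cgauss2 p \<rho>)) = 1"
    using nn_integral_cgauss2[OF p \<rho>, of "\<lambda>_. 1"] V.emeasure_space_1 P.emeasure_space_1 by simp
qed

text \<open>The noise of the first coordinate is merged with the conditional noise before the swap,
  that of the second coordinate after it. The outcome generates the second observation from the
  first.\<close>

lemma nn_integral_noisy_pair:
  fixes p s t :: real and \<rho> :: complex
  assumes p: "p > 0" and \<rho>: "cmod \<rho> < 1" and s: "s > 0" and t: "t > 0"
    and \<phi>[measurable]: "\<phi> \<in> borel_measurable (borel \<Otimes>\<^sub>M borel)"
  shows "(\<integral>\<^sup>+h. \<integral>\<^sup>+a. \<integral>\<^sup>+w. \<phi> (fst h + a, snd h + w) \<partial>cgauss t \<partial>cgauss s \<partial>cgauss2 p \<rho>)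
    = (\<integral>\<^sup>+x. \<integral>\<^sup>+n. \<phi> (x, of_real (p / (p + s)) * cnj \<rho> * x + n)
          \<partial>cgauss (((p + s) * (p + t) - p\<^sup>2 * (cmod \<rho>)\<^sup>2) / (p + s)) \<partial>cgauss (p + s))"
proof -
  define v where "v = p * (1 - (cmod \<rho>)\<^sup>2)"
  have "(cmod \<rho>)\<^sup>2 < 1"
    using \<rho> by (simp add: power_less_one_iff)
  then have v: "v > 0" using p by (simp add: v_def)
  define k where "k = of_real (p / (p + s)) * cnj \<rho>"
  define u where "u = p * (v + s) / (p + s)"
  have u: "u > 0" using p v s by (simp add: u_def)
  interpret S: prob_space "cgauss s" by (rule prob_space_cgauss[OF s])
  interpret T: prob_space "cgauss t" by (rule prob_space_cgauss[OF t])
  interpret V: prob_space "cgauss v" by (rule prob_space_cgauss[OF v])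
  have "(\<integral>\<^sup>+h. \<integral>\<^sup>+a. \<integral>\<^sup>+w. \<phi> (fst h + a, snd h + w) \<partial>cgauss t \<partial>cgauss s \<partial>cgauss2 p \<rho>)
      = (\<integral>\<^sup>+e. \<integral>\<^sup>+n. \<integral>\<^sup>+a. \<integral>\<^sup>+w. \<phi> (\<rho> * e + (n + a), e + w) \<partial>cgauss t \<partial>cgauss s \<partial>cgauss v \<partial>cgauss p)"
    by (subst nn_integral_cgauss2[OF p \<rho>]) (auto simp: v_def add.assoc)
  also have "\<dots> = (\<integral>\<^sup>+e. \<integral>\<^sup>+n. \<integral>\<^sup>+w. \<phi> (\<rho> * e + n, e + w) \<partial>cgauss t \<partial>cgauss (v + s) \<partial>cgauss p)"
    by (intro nn_integral_cong
          nn_integral_cgauss_add[OF v s, of "\<lambda>n. \<integral>\<^sup>+w. \<phi> (\<rho> * _ + n, _ + w) \<partial>cgauss t"]) simp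
  also have "\<dots> = (\<integral>\<^sup>+x. \<integral>\<^sup>+n. \<integral>\<^sup>+w. \<phi> (x, (k * x + n) + w) \<partial>cgauss t \<partial>cgauss u \<partial>cgauss (p + s))"
  proof -
    \<comment> \<open>This is the \<open>t\<close> of the swap lemma, the variance of the first
      noisy observation.\<close>
    have eq: "p * (cmod \<rho>)\<^sup>2 + (v + s) = p + s" by (simp add: v_def algebra_simps)
    show ?thesis
      using nn_integral_cgauss_swap[OF p add_pos_pos[OF v s],
          of "\<lambda>(x, e). \<integral>\<^sup>+w. \<phi> (x, e + w) \<partial>cgauss t" \<rho>]
      unfolding eq by (simp add: k_def u_def)
  qed
  also have "\<dots> = (\<integral>\<^sup>+x. \<integral>\<^sup>+n. \<phi> (x, k * x + n) \<partial>cgauss (u + t) \<partial>cgauss (p + s))"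
    by (intro nn_integral_cong)
       (simp add: nn_integral_cgauss_add[OF u t, of "\<lambda>n. \<phi> (_, k * _ + n)", symmetric] add.assoc)
  also have "u + t = ((p + s) * (p + t) - p\<^sup>2 * (cmod \<rho>)\<^sup>2) / (p + s)"
    using p s by (simp add: u_def v_def divide_simps) (simp add: algebra_simps power2_eq_square)
  finally show ?thesis unfolding k_def .
qed

definition envelope_density :: "real \<Rightarrow> real \<Rightarrow> real \<Rightarrow> real" where
  "envelope_density r x y =
     exp (- (r\<^sup>2 * (x\<^sup>2 + y\<^sup>2)) / (1 - r\<^sup>2)) * bessel_I0 (2 * r * x * y / (1 - r\<^sup>2)) / (1 - r\<^sup>2)"

lemma measurable_envelope_density [measurable (raw)]:
  assumes [measurable]: "f \<in> borel_measurable M" "g \<in> borel_measurable M"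
  shows "(\<lambda>x. envelope_density r (f x) (g x)) \<in> borel_measurable M"
  unfolding envelope_density_def by measurable

lemma envelope_density_pos: "0 \<le> r \<Longrightarrow> r < 1 \<Longrightarrow> envelope_density r x y > 0"
  using bessel_I0_pos by (simp add: envelope_density_def power_less_one_iff)

text \<open>For fixed \<open>z\<close> the second envelope is Rician about
  \<open>r * cmod z\<close>, with density relative to \<open>cgauss v\<close>. Multiplying by the
  ratio of the densities of \<open>cgauss v\<close> and \<open>cgauss 1\<close> makes the Rayleigh
  marginal the reference law.\<close>

lemma nn_integral_envelopes:
  assumes r: "0 \<le> r" "r < 1" and \<phi>[measurable]: "\<phi> \<in> borel_measurable (borel \<Otimes>\<^sub>M borel)"
  defines "s \<equiv> sqrt (1 - r\<^sup>2)"
  shows "(\<integral>\<^sup>+z. \<integral>\<^sup>+n. \<phi> (cmod z, cmod (of_real (r * cmod z) + of_real s * n)) \<partial>cgauss 1 \<partial>cgauss 1)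
    = (\<integral>\<^sup>+z. \<integral>\<^sup>+w. ennreal (envelope_density r (cmod z) (cmod w)) * \<phi> (cmod z, cmod w) \<partial>cgauss 1 \<partial>cgauss 1)"
proof (rule nn_integral_cong)
  fix z :: complex
  define v where "v = 1 - r\<^sup>2"
  have v: "v > 0" using r by (simp add: v_def power_less_one_iff)
  define q where "q = r * cmod z"
  have q: "q \<ge> 0" using r by (simp add: q_def)
  have "(\<integral>\<^sup>+n. \<phi> (cmod z, cmod (of_real q + of_real s * n)) \<partial>cgauss 1)
      = (\<integral>\<^sup>+n. \<phi> (cmod z, cmod (of_real q + n)) \<partial>cgauss v)"
    unfolding s_def v_def[symmetric]
    by (rule nn_integral_cgauss_scale[OF v, symmetric, of "\<lambda>n. \<phi> (cmod z, cmod (of_real q + n))"]) simp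
  also have "\<dots> = (\<integral>\<^sup>+w. ennreal (exp (- q\<^sup>2 / v) * bessel_I0 (2 * q * cmod w / v)) * \<phi> (cmod z, cmod w) \<partial>cgauss v)"
    using nn_integral_rician[OF v, of "\<lambda>y. \<phi> (cmod z, y)" "of_real q"] q by simp
  also have "\<dots> = (\<integral>\<^sup>+w. ennreal (cgauss_density v w)
      * (ennreal (exp (- q\<^sup>2 / v) * bessel_I0 (2 * q * cmod w / v)) * \<phi> (cmod z, cmod w)) \<partial>lborel)"
    by (subst nn_integral_cgauss) auto
  also have "\<dots> = (\<integral>\<^sup>+w. ennreal (cgauss_density 1 w)
      * (ennreal (envelope_density r (cmod z) (cmod w)) * \<phi> (cmod z, cmod w)) \<partial>lborel)"
  proof (intro nn_integral_cong)
    fix w :: complex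
    \<comment> \<open>The change of reference law works because
      \<open>1 / v - 1 = r\<^sup>2 / v\<close>, which makes the exponent symmetric in the two
      envelopes.\<close>
    have e: "- (cmod w)\<^sup>2 / v + - q\<^sup>2 / v = - (cmod w)\<^sup>2 / 1 + - (r\<^sup>2 * ((cmod z)\<^sup>2 + (cmod w)\<^sup>2)) / v"
      using v by (simp add: divide_simps v_def q_def) (simp add: algebra_simps power_mult_distrib)
    have "exp (- (cmod w)\<^sup>2 / v) * exp (- q\<^sup>2 / v)
        = exp (- (cmod w)\<^sup>2 / 1) * exp (- (r\<^sup>2 * ((cmod z)\<^sup>2 + (cmod w)\<^sup>2)) / v)"
      unfolding exp_add[symmetric] e ..
    then have "cgauss_density v w * (exp (- q\<^sup>2 / v) * bessel_I0 (2 * q * cmod w / v))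
        = cgauss_density 1 w * envelope_density r (cmod z) (cmod w)"
      using v unfolding cgauss_density_def envelope_density_def v_def[symmetric] q_def
      by (simp add: divide_simps mult_ac)
    then show "ennreal (cgauss_density v w)
      * (ennreal (exp (- q\<^sup>2 / v) * bessel_I0 (2 * q * cmod w / v)) * \<phi> (cmod z, cmod w))
      = ennreal (cgauss_density 1 w) * (ennreal (envelope_density r (cmod z) (cmod w)) * \<phi> (cmod z, cmod w))"
      using v envelope_density_pos[OF r] bessel_I0_pos
      by (simp add: mult.assoc[symmetric] ennreal_mult[symmetric] cgauss_density_nonneg less_imp_le)
  qed
  also have "\<dots> = (\<integral>\<^sup>+w. ennreal (envelope_density r (cmod z) (cmod w)) * \<phi> (cmod z, cmod w) \<partial>cgauss 1)"
    by (subst nn_integral_cgauss) auto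
  finally show "(\<integral>\<^sup>+n. \<phi> (cmod z, cmod (of_real (r * cmod z) + of_real s * n)) \<partial>cgauss 1)
    = (\<integral>\<^sup>+w. ennreal (envelope_density r (cmod z) (cmod w)) * \<phi> (cmod z, cmod w) \<partial>cgauss 1)"
    unfolding q_def .
qed

text \<open>Only the modulus of the centre matters, so \<open>r * cmod z\<close> may be replaced by
  \<open>r * z\<close>; then independent Gaussians of variances \<open>r\<^sup>2\<close> and
  \<open>1 - r\<^sup>2\<close> add up to variance 1.\<close>

lemma nn_integral_second_envelope:
  assumes r: "0 < r" "r < 1" and \<psi>[measurable]: "\<psi> \<in> borel_measurable borel"
  defines "s \<equiv> sqrt (1 - r\<^sup>2)"
  shows "(\<integral>\<^sup>+z. \<integral>\<^sup>+n. \<psi> (cmod (of_real (r * cmod z) + of_real s * n)) \<partial>cgauss 1 \<partial>cgauss 1)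
    = (\<integral>\<^sup>+w. \<psi> (cmod w) \<partial>cgauss 1)"
proof -
  have v: "1 - r\<^sup>2 > 0" and r2: "r\<^sup>2 > 0" using r by (simp_all add: power_less_one_iff)
  interpret V: prob_space "cgauss (1 - r\<^sup>2)" by (rule prob_space_cgauss[OF v])
  have "(\<integral>\<^sup>+z. \<integral>\<^sup>+n. \<psi> (cmod (of_real (r * cmod z) + of_real s * n)) \<partial>cgauss 1 \<partial>cgauss 1)
      = (\<integral>\<^sup>+z. \<integral>\<^sup>+n. \<psi> (cmod (of_real (r * cmod z) + n)) \<partial>cgauss (1 - r\<^sup>2) \<partial>cgauss 1)"
    unfolding s_def
    by (intro nn_integral_cong
          nn_integral_cgauss_scale[OF v, symmetric, of "\<lambda>n. \<psi> (cmod (of_real (r * cmod _) + n))"]) simp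
  also have "\<dots> = (\<integral>\<^sup>+z. \<integral>\<^sup>+n. \<psi> (cmod (of_real (sqrt (r\<^sup>2)) * z + n)) \<partial>cgauss (1 - r\<^sup>2) \<partial>cgauss 1)"
    using r by (intro nn_integral_cong nn_integral_rician_cong[OF v]) (auto simp: norm_mult)
  also have "\<dots> = (\<integral>\<^sup>+z. \<integral>\<^sup>+n. \<psi> (cmod (z + n)) \<partial>cgauss (1 - r\<^sup>2) \<partial>cgauss (r\<^sup>2))"
    by (rule nn_integral_cgauss_scale[OF r2, symmetric, of "\<lambda>z. \<integral>\<^sup>+n. \<psi> (cmod (z + n)) \<partial>cgauss (1 - r\<^sup>2)"]) simp
  also have "\<dots> = (\<integral>\<^sup>+w. \<psi> (cmod w) \<partial>cgauss 1)"
    using nn_integral_cgauss_add[OF r2 v, of "\<lambda>z. \<psi> (cmod z)"] by simp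
  finally show ?thesis .
qed

section \<open>Mutual information of the envelopes\<close>

lemma emeasure_distr_nn_integral:
  assumes "f \<in> measurable M N" "A \<in> sets N"
  shows "emeasure (distr M N f) A = (\<integral>\<^sup>+x. indicator A (f x) \<partial>M)"
  using assms nn_integral_distr[OF assms(1), of "indicator A"] by simp

text \<open>Normalisation: the phase of \<open>k * x\<close> is dropped, then both Gaussians are
  scaled to variance 1. Since \<open>V = a2 * (1 - r\<^sup>2)\<close>, the centre and the noise
  share the factor \<open>sqrt a2\<close>.\<close>

lemma nn_integral_noisy_envelopes:
  fixes p s t :: real and \<rho> :: complex
  assumes p: "p > 0" and \<rho>: "cmod \<rho> < 1" and s: "s > 0" and t: "t > 0"
    and \<phi>[measurable]: "\<phi> \<in> borel_measurable (borel \<Otimes>\<^sub>M borel)"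
  defines "r \<equiv> p * cmod \<rho> / sqrt ((p + s) * (p + t))"
  shows "(\<integral>\<^sup>+h. \<integral>\<^sup>+a. \<integral>\<^sup>+w. \<phi> (cmod (fst h + a), cmod (snd h + w)) \<partial>cgauss t \<partial>cgauss s \<partial>cgauss2 p \<rho>)
    = (\<integral>\<^sup>+z. \<integral>\<^sup>+n. \<phi> (sqrt (p + s) * cmod z,
          sqrt (p + t) * cmod (of_real (r * cmod z) + of_real (sqrt (1 - r\<^sup>2)) * n)) \<partial>cgauss 1 \<partial>cgauss 1)"
proof -
  define a1 a2 where "a1 = p + s" and "a2 = p + t"
  have a: "a1 > 0" "a2 > 0" using p s t by (auto simp: a1_def a2_def)
  define k where "k = of_real (p / a1) * cnj \<rho>"
  have r2: "r\<^sup>2 = p\<^sup>2 * (cmod \<rho>)\<^sup>2 / (a1 * a2)"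
    using a unfolding r_def a1_def[symmetric] a2_def[symmetric]
    by (simp add: power_divide power_mult_distrib)
  define V where "V = (a1 * a2 - p\<^sup>2 * (cmod \<rho>)\<^sup>2) / a1"
  have V: "V = a2 * (1 - r\<^sup>2)" unfolding r2 V_def using a by (simp add: field_simps)
  have "p\<^sup>2 * (cmod \<rho>)\<^sup>2 < a1 * a2"
  proof -
    have "(cmod \<rho>)\<^sup>2 \<le> 1" using \<rho> by (simp add: power_le_one)
    then have "p\<^sup>2 * (cmod \<rho>)\<^sup>2 \<le> p * p"
      using p by (simp add: power2_eq_square)
    also have "\<dots> < a1 * a2"
      using p s t unfolding a1_def a2_def by (intro mult_strict_mono) auto
    finally show ?thesis .
  qed
  then have Vpos: "V > 0" using a by (simp add: V_def)
  interpret V: prob_space "cgauss V" by (rule prob_space_cgauss[OF Vpos])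
  have "(\<integral>\<^sup>+h. \<integral>\<^sup>+a. \<integral>\<^sup>+w. \<phi> (cmod (fst h + a), cmod (snd h + w)) \<partial>cgauss t \<partial>cgauss s \<partial>cgauss2 p \<rho>)
      = (\<integral>\<^sup>+x. \<integral>\<^sup>+n. \<phi> (cmod x, cmod (k * x + n)) \<partial>cgauss V \<partial>cgauss a1)"
    using nn_integral_noisy_pair[OF p \<rho> s t, of "\<lambda>z. \<phi> (cmod (fst z), cmod (snd z))"]
    by (simp add: k_def V_def a1_def a2_def)
  also have "\<dots> = (\<integral>\<^sup>+x. \<integral>\<^sup>+n. \<phi> (cmod x, cmod (of_real (cmod (k * x)) + n)) \<partial>cgauss V \<partial>cgauss a1)"
    by (intro nn_integral_cong nn_integral_rician_cong[OF Vpos, of "\<lambda>y. \<phi> (cmod _, y)"]) auto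
  also have "\<dots> = (\<integral>\<^sup>+z. \<integral>\<^sup>+n. \<phi> (cmod (of_real (sqrt a1) * z), cmod (of_real (cmod (k * (of_real (sqrt a1) * z))) + n))
      \<partial>cgauss V \<partial>cgauss 1)"
    by (rule nn_integral_cgauss_scale[OF a(1),
          of "\<lambda>x. \<integral>\<^sup>+n. \<phi> (cmod x, cmod (of_real (cmod (k * x)) + n)) \<partial>cgauss V"]) simp
  also have "\<dots> = (\<integral>\<^sup>+z. \<integral>\<^sup>+n. \<phi> (cmod (of_real (sqrt a1) * z),
      cmod (of_real (cmod (k * (of_real (sqrt a1) * z))) + of_real (sqrt V) * n)) \<partial>cgauss 1 \<partial>cgauss 1)"
    by (intro nn_integral_cong nn_integral_cgauss_scale[OF Vpos, of "\<lambda>n. \<phi> (_, cmod (_ + n))"]) simp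
  also have "\<dots> = (\<integral>\<^sup>+z. \<integral>\<^sup>+n. \<phi> (sqrt a1 * cmod z,
      sqrt a2 * cmod (of_real (r * cmod z) + of_real (sqrt (1 - r\<^sup>2)) * n)) \<partial>cgauss 1 \<partial>cgauss 1)"
  proof (intro nn_integral_cong arg_cong[where f = \<phi>] arg_cong2[where f = Pair])
    fix z n :: complex
    show "cmod (of_real (sqrt a1) * z) = sqrt a1 * cmod z"
      using a by (simp add: norm_mult)
    have "cmod k = p * cmod \<rho> / a1"
      using a p by (simp add: k_def norm_mult norm_divide)
    then have "cmod k * sqrt a1 = sqrt a2 * r"
      using a p unfolding r_def a1_def[symmetric] a2_def[symmetric]
      by (simp add: real_sqrt_mult divide_simps mult.assoc)
    then have "cmod (k * (of_real (sqrt a1) * z)) = sqrt a2 * (r * cmod z)"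
      using a by (simp add: norm_mult mult.assoc[symmetric])
    moreover have "sqrt V = sqrt a2 * sqrt (1 - r\<^sup>2)"
      unfolding V by (rule real_sqrt_mult)
    ultimately have "of_real (cmod (k * (of_real (sqrt a1) * z))) + of_real (sqrt V) * n
        = of_real (sqrt a2) * (of_real (r * cmod z) + of_real (sqrt (1 - r\<^sup>2)) * n)"
      by (simp add: algebra_simps)
    then show "cmod (of_real (cmod (k * (of_real (sqrt a1) * z))) + of_real (sqrt V) * n)
        = sqrt a2 * cmod (of_real (r * cmod z) + of_real (sqrt (1 - r\<^sup>2)) * n)"
      using a by (simp add: norm_mult)
  qed
  finally show ?thesis unfolding a1_def a2_def .
qed

text \<open>The law of the pair is a hypothesis so that one proof serves both A and B. Relative
  entropy is the mean of the log density under the joint law, and that law is then carried over to a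
  fixed Gaussian pair.\<close>

lemma MI_noisy_pair:
  fixes p s t :: real and \<rho> :: complex and M :: "'a measure"
  assumes M: "prob_space M"
    and X[measurable]: "X1 \<in> borel_measurable M" "X2 \<in> borel_measurable M"
    and p: "p > 0" and \<rho>: "cmod \<rho> < 1" "\<rho> \<noteq> 0" and s: "s > 0" and t: "t > 0"
    and law: "\<And>\<phi> :: complex \<times> complex \<Rightarrow> ennreal. \<phi> \<in> borel_measurable (borel \<Otimes>\<^sub>M borel) \<Longrightarrow>
      (\<integral>\<^sup>+\<omega>. \<phi> (X1 \<omega>, X2 \<omega>) \<partial>M)
        = (\<integral>\<^sup>+h. \<integral>\<^sup>+a. \<integral>\<^sup>+w. \<phi> (fst h + a, snd h + w) \<partial>cgauss t \<partial>cgauss s \<partial>cgauss2 p \<rho>)"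
  defines "r \<equiv> p * cmod \<rho> / sqrt ((p + s) * (p + t))"
  shows "MI_bits M (\<lambda>\<omega>. cmod (X1 \<omega>)) (\<lambda>\<omega>. cmod (X2 \<omega>))
    = (\<integral>z. log 2 (envelope_density r (cmod (fst z))
          (cmod (of_real (r * cmod (fst z)) + of_real (sqrt (1 - r\<^sup>2)) * snd z))) \<partial>(cgauss 1 \<Otimes>\<^sub>M cgauss 1))"
proof -
  interpret M: prob_space M by fact
  interpret G: prob_space "cgauss 1" by (rule prob_space_cgauss) simp
  interpret GG: pair_prob_space "cgauss 1" "cgauss 1" ..
  define a1 a2 where "a1 = p + s" and "a2 = p + t"
  have a: "a1 > 0" "a2 > 0" using p s t by (auto simp: a1_def a2_def)
  have r: "0 < r" "r < 1"
  proof -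
    show "0 < r" using p s t \<rho> by (simp add: r_def)
    have "p * cmod \<rho> < p" using p \<rho> by simp
    also have "p = sqrt (p * p)" using p by simp
    also have "\<dots> < sqrt ((p + s) * (p + t))"
      using p s t by (intro real_sqrt_less_mono mult_strict_mono) auto
    finally show "r < 1" using p s t by (simp add: r_def)
  qed
  let ?R1 = "\<lambda>\<omega>. cmod (X1 \<omega>)" and ?R2 = "\<lambda>\<omega>. cmod (X2 \<omega>)"
  let ?Y = "\<lambda>z n. cmod (of_real (r * cmod z) + of_real (sqrt (1 - r\<^sup>2)) * n)"
  have env: "(\<integral>\<^sup>+\<omega>. \<phi> (?R1 \<omega>, ?R2 \<omega>) \<partial>M)
      = (\<integral>\<^sup>+z. \<integral>\<^sup>+n. \<phi> (sqrt a1 * cmod z, sqrt a2 * ?Y z n) \<partial>cgauss 1 \<partial>cgauss 1)"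
    if [measurable]: "\<phi> \<in> borel_measurable (borel \<Otimes>\<^sub>M borel)" for \<phi>
    using law[of "\<lambda>z. \<phi> (cmod (fst z), cmod (snd z))"] nn_integral_noisy_envelopes[OF p \<rho>(1) s t that]
    by (simp add: r_def a1_def a2_def)
  define P1 where "P1 = distr (cgauss 1) borel (\<lambda>z. sqrt a1 * cmod z)"
  define P2 where "P2 = distr (cgauss 1) borel (\<lambda>z. sqrt a2 * cmod z)"
  interpret P1: prob_space P1 unfolding P1_def by (rule G.prob_space_distr) simp
  interpret P2: prob_space P2 unfolding P2_def by (rule G.prob_space_distr) simp
  interpret PP: pair_prob_space P1 P2 ..
  have [measurable_cong, simp]: "sets P1 = sets borel" "sets P2 = sets borel"
    by (simp_all add: P1_def P2_def)
  have P1: "distr M borel ?R1 = P1"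
  proof (rule measure_eqI)
    fix A assume "A \<in> sets (distr M borel ?R1)"
    then have [measurable]: "A \<in> sets borel" by simp
    have "emeasure (distr M borel ?R1) A = (\<integral>\<^sup>+\<omega>. indicator A (?R1 \<omega>) \<partial>M)"
      by (subst emeasure_distr_nn_integral) auto
    also have "\<dots> = (\<integral>\<^sup>+z. indicator A (sqrt a1 * cmod z) \<partial>cgauss 1)"
      using env[of "\<lambda>z. indicator A (fst z)"] G.emeasure_space_1 by simp
    also have "\<dots> = emeasure P1 A"
      unfolding P1_def by (subst emeasure_distr_nn_integral) auto
    finally show "emeasure (distr M borel ?R1) A = emeasure P1 A" .
  qed simp
  have P2: "distr M borel ?R2 = P2"
  proof (rule measure_eqI)
    fix A assume "A \<in> sets (distr M borel ?R2)"
    then have [measurable]: "A \<in> sets borel" by simp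
    have "emeasure (distr M borel ?R2) A = (\<integral>\<^sup>+\<omega>. indicator A (?R2 \<omega>) \<partial>M)"
      by (subst emeasure_distr_nn_integral) auto
    also have "\<dots> = (\<integral>\<^sup>+z. \<integral>\<^sup>+n. indicator A (sqrt a2 * ?Y z n) \<partial>cgauss 1 \<partial>cgauss 1)"
      using env[of "\<lambda>z. indicator A (snd z)"] by simp
    also have "\<dots> = (\<integral>\<^sup>+z. indicator A (sqrt a2 * cmod z) \<partial>cgauss 1)"
      by (rule nn_integral_second_envelope[OF r, of "\<lambda>y. indicator A (sqrt a2 * y)"]) simp
    also have "\<dots> = emeasure P2 A"
      unfolding P2_def by (subst emeasure_distr_nn_integral) auto
    finally show "emeasure (distr M borel ?R2) A = emeasure P2 A" .
  qed simp
  \<comment> \<open>The envelopes under \<open>P1\<close> and \<open>P2\<close> are not normalised.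
    Mutual information is invariant under rescaling, which here just enters the arguments of the
    density.\<close>
  define f where "f z = envelope_density r (fst z / sqrt a1) (snd z / sqrt a2)" for z
  have f[measurable]: "f \<in> borel_measurable (borel \<Otimes>\<^sub>M borel)"
    unfolding f_def by measurable
  have f_pos: "0 < f z" for z
    using envelope_density_pos r by (simp add: f_def)
  have joint: "distr M (borel \<Otimes>\<^sub>M borel) (\<lambda>\<omega>. (?R1 \<omega>, ?R2 \<omega>)) = density (P1 \<Otimes>\<^sub>M P2) f"
  proof (rule measure_eqI)
    show "sets (distr M (borel \<Otimes>\<^sub>M borel) (\<lambda>\<omega>. (?R1 \<omega>, ?R2 \<omega>))) = sets (density (P1 \<Otimes>\<^sub>M P2) f)"
      by (simp cong: sets_pair_measure_cong)
    fix A assume "A \<in> sets (distr M (borel \<Otimes>\<^sub>M borel) (\<lambda>\<omega>. (?R1 \<omega>, ?R2 \<omega>)))"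
    then have A[measurable]: "A \<in> sets (borel \<Otimes>\<^sub>M borel)" by simp
    then have A': "A \<in> sets (P1 \<Otimes>\<^sub>M P2)" by (simp cong: sets_pair_measure_cong)
    have "emeasure (distr M (borel \<Otimes>\<^sub>M borel) (\<lambda>\<omega>. (?R1 \<omega>, ?R2 \<omega>))) A
        = (\<integral>\<^sup>+\<omega>. indicator A (?R1 \<omega>, ?R2 \<omega>) \<partial>M)"
      by (subst emeasure_distr_nn_integral) auto
    also have "\<dots> = (\<integral>\<^sup>+z. \<integral>\<^sup>+n. indicator A (sqrt a1 * cmod z, sqrt a2 * ?Y z n) \<partial>cgauss 1 \<partial>cgauss 1)"
      by (rule env) simp
    also have "\<dots> = (\<integral>\<^sup>+z. \<integral>\<^sup>+w. ennreal (f (sqrt a1 * cmod z, sqrt a2 * cmod w))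
        * indicator A (sqrt a1 * cmod z, sqrt a2 * cmod w) \<partial>cgauss 1 \<partial>cgauss 1)"
      using nn_integral_envelopes[of r "\<lambda>z. indicator A (sqrt a1 * fst z, sqrt a2 * snd z)"] r a
      by (simp add: f_def)
    also have "\<dots> = (\<integral>\<^sup>+x. \<integral>\<^sup>+y. ennreal (f (x, y)) * indicator A (x, y) \<partial>P2 \<partial>P1)"
      unfolding P1_def P2_def by (simp add: nn_integral_distr)
    also have "\<dots> = (\<integral>\<^sup>+z. ennreal (f z) * indicator A z \<partial>(P1 \<Otimes>\<^sub>M P2))"
      by (rule P2.nn_integral_fst) simp
    also have "\<dots> = emeasure (density (P1 \<Otimes>\<^sub>M P2) f) A"
      using A' by (subst emeasure_density) auto
    finally show "emeasure (distr M (borel \<Otimes>\<^sub>M borel) (\<lambda>\<omega>. (?R1 \<omega>, ?R2 \<omega>))) A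
        = emeasure (density (P1 \<Otimes>\<^sub>M P2) f) A" .
  qed
  \<comment> \<open>A second description of the same joint law: as a density it gives the relative
    entropy, as an image of the Gaussian pair it gives the expectation.\<close>
  have joint2: "distr M (borel \<Otimes>\<^sub>M borel) (\<lambda>\<omega>. (?R1 \<omega>, ?R2 \<omega>))
      = distr (cgauss 1 \<Otimes>\<^sub>M cgauss 1) (borel \<Otimes>\<^sub>M borel)
          (\<lambda>z. (sqrt a1 * cmod (fst z), sqrt a2 * ?Y (fst z) (snd z)))"
    (is "?D = distr _ _ ?T")
  proof (rule measure_eqI)
    fix A assume "A \<in> sets ?D"
    then have A[measurable]: "A \<in> sets (borel \<Otimes>\<^sub>M borel)" by simp
    have "emeasure ?D A = (\<integral>\<^sup>+\<omega>. indicator A (?R1 \<omega>, ?R2 \<omega>) \<partial>M)"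
      by (subst emeasure_distr_nn_integral) auto
    also have "\<dots> = (\<integral>\<^sup>+z. \<integral>\<^sup>+n. indicator A (?T (z, n)) \<partial>cgauss 1 \<partial>cgauss 1)"
      by (simp add: env)
    also have "\<dots> = (\<integral>\<^sup>+z. indicator A (?T z) \<partial>(cgauss 1 \<Otimes>\<^sub>M cgauss 1))"
      by (rule G.nn_integral_fst) simp
    also have "\<dots> = emeasure (distr (cgauss 1 \<Otimes>\<^sub>M cgauss 1) (borel \<Otimes>\<^sub>M borel) ?T) A"
      by (subst emeasure_distr_nn_integral) auto
    finally show "emeasure ?D A = emeasure (distr (cgauss 1 \<Otimes>\<^sub>M cgauss 1) (borel \<Otimes>\<^sub>M borel) ?T) A" .
  qed simp
  have "MI_bits M ?R1 ?R2 = KL_divergence 2 (P1 \<Otimes>\<^sub>M P2) (density (P1 \<Otimes>\<^sub>M P2) f)"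
    unfolding MI_bits_def M.mutual_information_def P1 P2 joint ..
  also have "\<dots> = (\<integral>z. f z * log 2 (f z) \<partial>(P1 \<Otimes>\<^sub>M P2))"
    using f_pos by (intro PP.P.KL_density) (auto simp: less_imp_le)
  also have "\<dots> = (\<integral>z. log 2 (f z) \<partial>(density (P1 \<Otimes>\<^sub>M P2) f))"
    using f_pos by (subst integral_density) (auto simp: less_imp_le)
  also have "\<dots> = (\<integral>z. log 2 (f (?T z)) \<partial>(cgauss 1 \<Otimes>\<^sub>M cgauss 1))"
    unfolding joint[symmetric] joint2 by (subst integral_distr) auto
  finally show ?thesis
    using a by (simp add: f_def)
qed

section \<open>From the channel model to a function of the correlation alone\<close>

lemma nn_integral_channel_model:
  assumes ch: "channel_model M p \<rho> sA sB sE H HE WA WB WE"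
    and pos: "p > 0" "cmod \<rho> < 1" "sA > 0" "sB > 0" "sE > 0"
    and \<psi>[measurable]: "\<psi> \<in> borel_measurable ((borel \<Otimes>\<^sub>M borel) \<Otimes>\<^sub>M (borel \<Otimes>\<^sub>M (borel \<Otimes>\<^sub>M borel)))"
  shows "(\<integral>\<^sup>+\<omega>. \<psi> ((H \<omega>, HE \<omega>), (WA \<omega>, (WB \<omega>, WE \<omega>))) \<partial>M)
    = (\<integral>\<^sup>+h. \<integral>\<^sup>+a. \<integral>\<^sup>+b. \<integral>\<^sup>+e. \<psi> (h, (a, (b, e))) \<partial>cgauss sE \<partial>cgauss sB \<partial>cgauss sA \<partial>cgauss2 p \<rho>)"
proof -
  interpret A: prob_space "cgauss sA" by (rule prob_space_cgauss) fact
  interpret B: prob_space "cgauss sB" by (rule prob_space_cgauss) fact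
  interpret E: prob_space "cgauss sE" by (rule prob_space_cgauss) fact
  interpret H: prob_space "cgauss2 p \<rho>" by (rule prob_space_cgauss2) fact+
  interpret BE: pair_prob_space "cgauss sB" "cgauss sE" ..
  interpret ABE: pair_prob_space "cgauss sA" "cgauss sB \<Otimes>\<^sub>M cgauss sE" ..
  let ?T = "cgauss2 p \<rho> \<Otimes>\<^sub>M (cgauss sA \<Otimes>\<^sub>M (cgauss sB \<Otimes>\<^sub>M cgauss sE))"
  let ?X = "\<lambda>\<omega>. ((H \<omega>, HE \<omega>), (WA \<omega>, (WB \<omega>, WE \<omega>)))"
  have X: "?X \<in> measurable M ?T" and D: "distr M ?T ?X = ?T"
    using ch by (auto simp: channel_model_def Let_def)
  have [measurable]: "\<psi> \<in> borel_measurable ?T"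
    using \<psi> by (simp cong: measurable_cong_sets sets_pair_measure_cong)
  have "(\<integral>\<^sup>+\<omega>. \<psi> (?X \<omega>) \<partial>M) = (\<integral>\<^sup>+x. \<psi> x \<partial>?T)"
    by (subst D[symmetric], subst nn_integral_distr[OF X]) auto
  also have "\<dots> = (\<integral>\<^sup>+h. \<integral>\<^sup>+x. \<psi> (h, x) \<partial>(cgauss sA \<Otimes>\<^sub>M (cgauss sB \<Otimes>\<^sub>M cgauss sE)) \<partial>cgauss2 p \<rho>)"
    by (rule ABE.nn_integral_fst[symmetric]) simp
  also have "\<dots> = (\<integral>\<^sup>+h. \<integral>\<^sup>+a. \<integral>\<^sup>+x. \<psi> (h, (a, x)) \<partial>(cgauss sB \<Otimes>\<^sub>M cgauss sE) \<partial>cgauss sA \<partial>cgauss2 p \<rho>)"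
    by (subst BE.nn_integral_fst[symmetric]) auto
  also have "\<dots> = (\<integral>\<^sup>+h. \<integral>\<^sup>+a. \<integral>\<^sup>+b. \<integral>\<^sup>+e. \<psi> (h, (a, (b, e))) \<partial>cgauss sE \<partial>cgauss sB \<partial>cgauss sA \<partial>cgauss2 p \<rho>)"
    by (subst E.nn_integral_fst[symmetric]) auto
  finally show ?thesis .
qed

lemma channel_model_measurable:
  assumes "channel_model M p \<rho> sA sB sE H HE WA WB WE"
  shows "H \<in> borel_measurable M" "HE \<in> borel_measurable M" "WA \<in> borel_measurable M"
    "WB \<in> borel_measurable M" "WE \<in> borel_measurable M"
proof -
  let ?X = "\<lambda>\<omega>. ((H \<omega>, HE \<omega>), (WA \<omega>, (WB \<omega>, WE \<omega>)))"
  have "?X \<in> measurable M (cgauss2 p \<rho> \<Otimes>\<^sub>M (cgauss sA \<Otimes>\<^sub>M (cgauss sB \<Otimes>\<^sub>M cgauss sE)))"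
    using assms by (auto simp: channel_model_def Let_def)
  then have X[measurable]: "?X \<in> measurable M ((borel \<Otimes>\<^sub>M borel) \<Otimes>\<^sub>M (borel \<Otimes>\<^sub>M (borel \<Otimes>\<^sub>M borel)))"
    by (simp cong: measurable_cong_sets sets_pair_measure_cong)
  show "H \<in> borel_measurable M"
    using measurable_compose[OF X, of "\<lambda>x. fst (fst x)" borel] by simp
  show "HE \<in> borel_measurable M"
    using measurable_compose[OF X, of "\<lambda>x. snd (fst x)" borel] by simp
  show "WA \<in> borel_measurable M"
    using measurable_compose[OF X, of "\<lambda>x. fst (snd x)" borel] by simp
  show "WB \<in> borel_measurable M"
    using measurable_compose[OF X, of "\<lambda>x. fst (snd (snd x))" borel] by simp
  show "WE \<in> borel_measurable M"
    using measurable_compose[OF X, of "\<lambda>x. snd (snd (snd x))" borel] by simp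
qed

text \<open>The probability space is fixed; all channel parameters act through the modulus
  \<open>r\<close> of the correlation coefficient of the noisy pair.\<close>

definition envelope_MI :: "real \<Rightarrow> real" where
  "envelope_MI r = (\<integral>z. log 2 (envelope_density r (cmod (fst z))
      (cmod (of_real (r * cmod (fst z)) + of_real (sqrt (1 - r\<^sup>2)) * snd z))) \<partial>(cgauss 1 \<Otimes>\<^sub>M cgauss 1))"

lemma MI_channel_A:
  assumes ch: "channel_model M p \<rho> sA sB sE H HE WA WB WE"
    and pos: "p > 0" "cmod \<rho> < 1" "\<rho> \<noteq> 0" "sA > 0" "sB > 0" "sE > 0"
  shows "MI_bits M (\<lambda>\<omega>. cmod (H \<omega> + WA \<omega>)) (\<lambda>\<omega>. cmod (HE \<omega> + WE \<omega>))
    = envelope_MI (p * cmod \<rho> / sqrt ((p + sA) * (p + sE)))"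
  unfolding envelope_MI_def
proof (rule MI_noisy_pair)
  note [measurable] = channel_model_measurable[OF ch]
  interpret B: prob_space "cgauss sB" by (rule prob_space_cgauss) fact
  interpret E: prob_space "cgauss sE" by (rule prob_space_cgauss) fact
  show "prob_space M" using ch by (simp add: channel_model_def)
  show "(\<lambda>\<omega>. H \<omega> + WA \<omega>) \<in> borel_measurable M" "(\<lambda>\<omega>. HE \<omega> + WE \<omega>) \<in> borel_measurable M"
    by measurable
  fix \<phi> :: "complex \<times> complex \<Rightarrow> ennreal"
  assume [measurable]: "\<phi> \<in> borel_measurable (borel \<Otimes>\<^sub>M borel)"
  show "(\<integral>\<^sup>+\<omega>. \<phi> (H \<omega> + WA \<omega>, HE \<omega> + WE \<omega>) \<partial>M)
        = (\<integral>\<^sup>+h. \<integral>\<^sup>+a. \<integral>\<^sup>+w. \<phi> (fst h + a, snd h + w) \<partial>cgauss sE \<partial>cgauss sA \<partial>cgauss2 p \<rho>)"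
    using nn_integral_channel_model[OF ch pos(1,2,4,5,6),
        of "\<lambda>x. \<phi> (fst (fst x) + fst (snd x), snd (fst x) + snd (snd (snd x)))"] B.emeasure_space_1
    by simp
qed fact+

lemma MI_channel_B:
  assumes ch: "channel_model M p \<rho> sA sB sE H HE WA WB WE"
    and pos: "p > 0" "cmod \<rho> < 1" "\<rho> \<noteq> 0" "sA > 0" "sB > 0" "sE > 0"
  shows "MI_bits M (\<lambda>\<omega>. cmod (H \<omega> + WB \<omega>)) (\<lambda>\<omega>. cmod (HE \<omega> + WE \<omega>))
    = envelope_MI (p * cmod \<rho> / sqrt ((p + sB) * (p + sE)))"
  unfolding envelope_MI_def
proof (rule MI_noisy_pair)
  note [measurable] = channel_model_measurable[OF ch]
  interpret A: prob_space "cgauss sA" by (rule prob_space_cgauss) fact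
  interpret B: prob_space "cgauss sB" by (rule prob_space_cgauss) fact
  interpret E: prob_space "cgauss sE" by (rule prob_space_cgauss) fact
  show "prob_space M" using ch by (simp add: channel_model_def)
  show "(\<lambda>\<omega>. H \<omega> + WB \<omega>) \<in> borel_measurable M" "(\<lambda>\<omega>. HE \<omega> + WE \<omega>) \<in> borel_measurable M"
    by measurable
  fix \<phi> :: "complex \<times> complex \<Rightarrow> ennreal"
  assume [measurable]: "\<phi> \<in> borel_measurable (borel \<Otimes>\<^sub>M borel)"
  show "(\<integral>\<^sup>+\<omega>. \<phi> (H \<omega> + WB \<omega>, HE \<omega> + WE \<omega>) \<partial>M)
        = (\<integral>\<^sup>+h. \<integral>\<^sup>+a. \<integral>\<^sup>+w. \<phi> (fst h + a, snd h + w) \<partial>cgauss sE \<partial>cgauss sB \<partial>cgauss2 p \<rho>)"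
    using nn_integral_channel_model[OF ch pos(1,2,4,5,6),
        of "\<lambda>x. \<phi> (fst (fst x) + fst (snd (snd x)), snd (fst x) + snd (snd (snd x)))"] A.emeasure_space_1
    by simp
qed fact+

section \<open>Moments of the Rayleigh law\<close>

text \<open>The squared modulus is exponential with rate 1, so this is Euler's integral. The range
  of \<open>a\<close> includes \<open>-1/2\<close>, the inverse envelope, and a neighbourhood of 0,
  from which the logarithm is obtained.\<close>

lemma has_bochner_integral_cgauss_powr:
  fixes a :: real
  assumes a: "a > -1"
  shows "has_bochner_integral (cgauss 1) (\<lambda>z. (cmod z)\<^sup>2 powr a) (Gamma (a + 1))"
proof (rule has_bochner_integral_nn_integral)
  let ?f = "\<lambda>u::real. u powr a / exp u * indicator {0..} u"
  have "((\<lambda>u::real. u powr a / exp u) has_integral Gamma (a + 1)) {0..}"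
    using Gamma_integral_real[of "a + 1"] a by simp
  moreover have "?f = (\<lambda>u. if u \<in> {0..} then u powr a / exp u else 0)"
    by (auto split: split_indicator)
  ultimately have "(?f has_integral Gamma (a + 1)) UNIV"
    by (simp only: has_integral_restrict_UNIV)
  then have "(\<integral>\<^sup>+u. ennreal (?f u) \<partial>lborel) = ennreal (Gamma (a + 1))"
    by (intro nn_integral_has_integral_lborel) auto
  moreover have "(\<integral>\<^sup>+z. ennreal ((cmod z)\<^sup>2 powr a) \<partial>cgauss 1) = (\<integral>\<^sup>+u. ennreal (?f u) \<partial>lborel)"
    by (subst nn_integral_cgauss_cmod_sq[of 1 "\<lambda>u. ennreal (u powr a)"])
       (auto simp: exponential_density_def ennreal_mult'[symmetric] exp_minus field_simps
          intro!: nn_integral_cong split: split_indicator)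
  ultimately show "(\<integral>\<^sup>+z. ennreal ((cmod z)\<^sup>2 powr a) \<partial>cgauss 1) = ennreal (Gamma (a + 1))"
    by simp
  show "0 \<le> Gamma (a + 1)" using a Gamma_real_pos[of "a + 1"] by simp
qed auto

lemma AE_cgauss_nonzero: "AE z in cgauss v. z \<noteq> 0"
  unfolding cgauss_eq_density by (subst AE_density) (auto intro: AE_mp[OF AE_lborel_singleton[of 0]])

lemma has_bochner_integral_cgauss_cmod_sq: "has_bochner_integral (cgauss 1) (\<lambda>z. (cmod z)\<^sup>2) 1"
  using has_bochner_integral_cgauss_powr[of 1] Gamma_numeral[of "num.Bit0 num.One", where 'a = real]
  by simp

lemma integrable_cgauss_inverse_cmod: "integrable (cgauss 1) (\<lambda>z. 1 / cmod z)"
proof -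
  have "(cmod z)\<^sup>2 powr (-1/2) = 1 / cmod z" for z
    \<comment> \<open>At \<open>z = 0\<close> both sides are 0, since \<open>0 powr a = 0\<close>
      and \<open>1 / 0 = 0\<close>.\<close>
    by (cases "z = 0") (auto simp: powr_minus_divide powr_half_sqrt)
  then show ?thesis
    using has_bochner_integral_cgauss_powr[of "-1/2"] by (simp add: has_bochner_integral_iff)
qed

text \<open>Both are \<open>1 + x <= exp x\<close> at \<open>x = h * ln u\<close> and
  \<open>x = - h * ln u\<close>; they enclose the logarithm between difference quotients of
  powers.\<close>

lemma ln_powr_bounds:
  fixes u h :: real
  assumes "u > 0" "h > 0"
  shows "ln u \<le> (u powr h - 1) / h" "(1 - u powr (- h)) / h \<le> ln u"
  using assms exp_ge_add_one_self[of "h * ln u"] exp_ge_add_one_self[of "- h * ln u"]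
  by (simp_all add: powr_def field_simps)

text \<open>Taking means in \<open>ln_powr_bounds\<close> encloses the mean of
  \<open>ln (U z)\<close> between the left and right difference quotients of \<open>Gamma\<close> at
  1. Both tend to the derivative there, minus the Euler-Mascheroni constant, and no derivative is
  taken under the integral.\<close>

lemma has_bochner_integral_cgauss_ln:
  "has_bochner_integral (cgauss 1) (\<lambda>z. ln (cmod z)) (- euler_mascheroni / 2)"
proof -
  interpret prob_space "cgauss 1" by (rule prob_space_cgauss) simp
  define U where "U z = (cmod z)\<^sup>2" for z
  have [measurable]: "U \<in> borel_measurable borel" unfolding U_def by measurable
  have U: "AE z in cgauss 1. U z > 0"
    using AE_cgauss_nonzero[of 1] by eventually_elim (simp add: U_def)
  have powr: "integrable (cgauss 1) (\<lambda>z. U z powr h)" "(\<integral>z. U z powr h \<partial>cgauss 1) = Gamma (1 + h)"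
    if "h > -1" for h
    using has_bochner_integral_cgauss_powr[OF that] by (auto simp: has_bochner_integral_iff U_def add.commute)
  have int: "integrable (cgauss 1) (\<lambda>z. ln (U z))"
  proof (rule Bochner_Integration.integrable_bound)
    \<comment> \<open>Both bounds are taken with \<open>h = 1/2\<close>: the moments of
      \<open>U\<close> of orders \<open>1/2\<close> and \<open>-1/2\<close> are finite.\<close>
    show "integrable (cgauss 1) (\<lambda>z. \<bar>(U z powr (1/2) - 1) / (1/2)\<bar> + \<bar>(1 - U z powr (- (1/2))) / (1/2)\<bar>)"
      using powr(1)[of "1/2"] powr(1)[of "-(1/2)"] by (intro integrable_abs Bochner_Integration.integrable_add integrable_divide Bochner_Integration.integrable_diff) auto
    show "AE z in cgauss 1. norm (ln (U z)) \<le> norm (\<bar>(U z powr (1/2) - 1) / (1/2)\<bar> + \<bar>(1 - U z powr (- (1/2))) / (1/2)\<bar>)"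
      using U
    proof eventually_elim
      case (elim z)
      then show ?case
        using ln_powr_bounds[of "U z" "1/2"] by (simp del: times_divide_eq_right)
    qed
  qed measurable
  have up: "(\<integral>z. ln (U z) \<partial>cgauss 1) \<le> (Gamma (1 + h) - 1) / h" if h: "h > 0" for h
  proof -
    have "(\<integral>z. ln (U z) \<partial>cgauss 1) \<le> (\<integral>z. (U z powr h - 1) / h \<partial>cgauss 1)"
      using U powr[of h] h int by (intro integral_mono_AE) (auto simp: ln_powr_bounds elim: AE_mp)
    also have "\<dots> = (Gamma (1 + h) - 1) / h"
      using powr[of h] h by (simp add: prob_space[simplified])
    finally show ?thesis .
  qed
  have lo: "(Gamma (1 + h) - 1) / h \<le> (\<integral>z. ln (U z) \<partial>cgauss 1)" if h: "h < 0" "h > -1" for h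
  proof -
    have "(\<integral>z. (1 - U z powr (- (- h))) / (- h) \<partial>cgauss 1) \<le> (\<integral>z. ln (U z) \<partial>cgauss 1)"
      using U powr[of h] h int ln_powr_bounds(2)[of _ "- h"] by (intro integral_mono_AE) (auto elim!: AE_mp)
    also have "(\<integral>z. (1 - U z powr (- (- h))) / (- h) \<partial>cgauss 1) = (Gamma (1 + h) - 1) / h"
      using powr[of h] h by (simp add: prob_space[simplified] field_simps)
    finally show ?thesis .
  qed
  have "(Gamma has_field_derivative Gamma 1 * Digamma 1) (at (1::real))"
    by (rule has_field_derivative_Gamma) auto
  then have lim: "((\<lambda>h. (Gamma (1 + h) - 1) / h) \<longlongrightarrow> - euler_mascheroni) (at (0::real))"
    by (simp add: DERIV_def)
  have "(\<integral>z. ln (U z) \<partial>cgauss 1) \<le> - euler_mascheroni"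
    by (rule tendsto_lowerbound[OF tendsto_mono[OF at_le lim, of "{0<..}"]])
       (auto simp: eventually_at_filter intro!: always_eventually up)
  moreover have "- euler_mascheroni \<le> (\<integral>z. ln (U z) \<partial>cgauss 1)"
  proof (rule tendsto_upperbound[OF tendsto_mono[OF at_le lim, of "{..<0}"]])
    show "\<forall>\<^sub>F h in at_left 0. (Gamma (1 + h) - 1) / h \<le> (\<integral>z. ln (U z) \<partial>cgauss 1)"
      using eventually_at_left_real[of "-1" "0::real"] by (auto elim!: eventually_mono intro!: lo)
  qed auto
  ultimately have "(\<integral>z. ln (U z) \<partial>cgauss 1) = - euler_mascheroni" by simp
  then have "has_bochner_integral (cgauss 1) (\<lambda>z. ln (U z) / 2) (- euler_mascheroni / 2)"
    using int by (simp add: has_bochner_integral_iff)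
  moreover have "ln (U z) / 2 = ln (cmod z)" for z
    \<comment> \<open>The origin is covered by the convention \<open>ln 0 = 0\<close>.\<close>
    by (cases "z = 0") (simp_all add: U_def ln_realpow)
  ultimately show ?thesis by simp
qed

text \<open>Rotation by \<open>\<i>\<close> exchanges the squares of the two parts, so they have
  equal means, and the sum of these means is 1.\<close>

lemma has_bochner_integral_cgauss_Re_sq: "has_bochner_integral (cgauss 1) (\<lambda>z. (Re z)\<^sup>2) (1 / 2)"
proof -
  have le: "(Re z)\<^sup>2 \<le> (cmod z)\<^sup>2" "(Im z)\<^sup>2 \<le> (cmod z)\<^sup>2" for z
    by (simp_all add: cmod_power2)
  have int: "integrable (cgauss 1) (\<lambda>z. (cmod z)\<^sup>2)" "(\<integral>z. (cmod z)\<^sup>2 \<partial>cgauss 1) = 1"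
    using has_bochner_integral_cgauss_cmod_sq by (auto simp: has_bochner_integral_iff)
  have R: "integrable (cgauss 1) (\<lambda>z. (Re z)\<^sup>2)"
    by (rule Bochner_Integration.integrable_bound[OF int(1)]) (auto simp: le)
  have I: "integrable (cgauss 1) (\<lambda>z. (Im z)\<^sup>2)"
    by (rule Bochner_Integration.integrable_bound[OF int(1)]) (auto simp: le)
  have "(\<integral>\<^sup>+z. ennreal ((Im z)\<^sup>2) \<partial>cgauss 1) = (\<integral>\<^sup>+z. ennreal ((Re z)\<^sup>2) \<partial>cgauss 1)"
    using nn_integral_cgauss_rotate[of \<i> "\<lambda>z. ennreal ((Re z)\<^sup>2)" 1] by simp
  then have "(\<integral>z. (Im z)\<^sup>2 \<partial>cgauss 1) = (\<integral>z. (Re z)\<^sup>2 \<partial>cgauss 1)"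
    by (simp add: integral_eq_nn_integral)
  moreover have "(\<integral>z. (cmod z)\<^sup>2 \<partial>cgauss 1) = (\<integral>z. (Re z)\<^sup>2 \<partial>cgauss 1) + (\<integral>z. (Im z)\<^sup>2 \<partial>cgauss 1)"
    using R I by (simp add: cmod_power2)
  ultimately show ?thesis using int R by (simp add: has_bochner_integral_iff)
qed

section \<open>Asymptotics of the Bessel function\<close>

text \<open>A quadratic bound on the whole period, for domination. With \<open>y\<close> half the
  modulus of the angle, \<open>pi < 4\<close> gives \<open>y <= 2\<close>, hence
  \<open>sin y >= y - y ^ 3 / 6 >= y / 3\<close>; then \<open>1 - cos = 2 * sin\<^sup>2\<close>
  yields 1/18.\<close>

lemma one_minus_cos_ge:
  fixes \<theta> :: real
  assumes "\<bar>\<theta>\<bar> \<le> pi"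
  shows "1 - cos \<theta> \<ge> \<theta>\<^sup>2 / 18"
proof -
  define y where "y = \<bar>\<theta>\<bar> / 2"
  have y: "0 \<le> y" "y \<le> 2" using assms pi_less_4 by (auto simp: y_def)
  have "\<bar>sin y - y\<bar> \<le> y ^ 3 / 6"
    using Maclaurin_sin_bound[of y 3] y by (simp add: numeral_eq_Suc sin_coeff_def)
  moreover have "y ^ 3 \<le> 4 * y"
    using mult_right_mono[OF power_mono[OF y(2,1), of 2] y(1)] by (simp add: power3_eq_cube power2_eq_square)
  ultimately have "y / 3 \<le> sin y" by linarith
  then have "(y / 3)\<^sup>2 \<le> (sin y)\<^sup>2" using y by (intro power_mono) auto
  moreover have "cos \<theta> = 1 - 2 * (sin y)\<^sup>2"
    using cos_double_sin[of y] by (simp add: y_def)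
  ultimately show ?thesis by (simp add: y_def power_divide)
qed

text \<open>Laplace's method: the substitution \<open>\<theta> = t / sqrt x\<close> gives the peak
  at angle 0 a width independent of \<open>x\<close>.\<close>

lemma bessel_I0_scaled_eq:
  assumes x: "x > 0"
  shows "sqrt (2 * pi * x) * exp (- x) * bessel_I0 x
    = (\<integral>t. exp (- x * (1 - cos (t / sqrt x))) * indicator {-pi..<pi} (t / sqrt x) \<partial>lborel) / sqrt (2 * pi)"
proof -
  have "(\<integral>\<theta>. exp (x * cos \<theta>) * indicator {-pi..<pi} \<theta> \<partial>lborel)
      = 1 / sqrt x * (\<integral>t. exp (x * cos (t / sqrt x)) * indicator {-pi..<pi} (t / sqrt x) \<partial>lborel)"
    using lborel_integral_real_affine[of "1 / sqrt x" "\<lambda>\<theta>. exp (x * cos \<theta>) * indicator {-pi..<pi} \<theta>" 0] x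
    by simp
  moreover have "exp (- x) * (\<integral>t. exp (x * cos (t / sqrt x)) * indicator {-pi..<pi} (t / sqrt x) \<partial>lborel)
      = (\<integral>t. exp (- x * (1 - cos (t / sqrt x))) * indicator {-pi..<pi} (t / sqrt x) \<partial>lborel)"
    by (subst integral_mult_right_zero[symmetric])
       (auto simp: mult.assoc[symmetric] exp_add[symmetric] algebra_simps intro!: Bochner_Integration.integral_cong)
  moreover have "sqrt (2 * pi * x) / (2 * pi) * (1 / sqrt x) = 1 / sqrt (2 * pi)"
  proof -
    have "sqrt (2 * pi * x) = sqrt (2 * pi) * sqrt x"
      by (rule real_sqrt_mult)
    moreover have "sqrt (2 * pi) * sqrt (2 * pi) = 2 * pi"
      by simp
    ultimately show ?thesis using x by (simp add: divide_simps)
  qed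
  moreover have "sqrt (2 * pi * x) * exp (- x) * bessel_I0 x = (sqrt (2 * pi * x) / (2 * pi) * (1 / sqrt x))
      * (exp (- x) * (\<integral>t. exp (x * cos (t / sqrt x)) * indicator {-pi..<pi} (t / sqrt x) \<partial>lborel))"
    unfolding bessel_I0_def calculation(1) by (simp add: mult_ac)
  ultimately show ?thesis by simp
qed

lemma bessel_I0_asymptotics:
  "((\<lambda>x. sqrt (2 * pi * x) * exp (- x) * bessel_I0 x) \<longlongrightarrow> 1) at_top"
proof -
  let ?s = "\<lambda>x t. exp (- x * (1 - cos (t / sqrt x))) * indicator {-pi..<pi} (t / sqrt x) :: real"
  have "((\<lambda>x. \<integral>t. ?s x t \<partial>lborel) \<longlongrightarrow> (\<integral>t. exp (- t\<^sup>2 / 2) \<partial>lborel)) at_top"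
  proof (rule integral_dominated_convergence_at_top)
    \<comment> \<open>The dominating function is a multiple of a normal density with standard
      deviation 3.\<close>
    have "exp (- t\<^sup>2 / 18) = sqrt (2 * pi * 9) * normal_density 0 3 t" for t :: real
      by (simp add: normal_density_def)
    then show "integrable lborel (\<lambda>t::real. exp (- t\<^sup>2 / 18))"
      by (simp only: integrable_mult_right integrable_normal_density)
    show "\<forall>\<^sub>F x in at_top. AE t in lborel. norm (?s x t) \<le> exp (- t\<^sup>2 / 18)"
      using eventually_gt_at_top[of 0]
    proof eventually_elim
      case (elim x)
      have "- x * (1 - cos (t / sqrt x)) \<le> - t\<^sup>2 / 18" if "t / sqrt x \<in> {-pi..<pi}" for t
        using mult_left_mono[OF one_minus_cos_ge[of "t / sqrt x"], of x] that elim
        by (auto simp: power_divide)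
      then show ?case by (auto split: split_indicator)
    qed
    have "((\<lambda>x. ?s x t) \<longlongrightarrow> exp (- t\<^sup>2 / 2)) at_top" for t :: real
    proof -
      have c: "((\<lambda>x. exp (- x * (1 - cos (t / sqrt x)))) \<longlongrightarrow> exp (- t\<^sup>2 / 2)) at_top"
      \<comment> \<open>The asymptotic expansion requires the sign of \<open>t\<close>.\<close>
      proof (cases t "0::real" rule: linorder_cases)
        case less
        then show ?thesis by real_asymp (simp add: power2_eq_square)
      next
        case greater
        then show ?thesis by real_asymp (simp add: power2_eq_square)
      qed simp
      have "((\<lambda>x. t / sqrt x) \<longlongrightarrow> 0) at_top" by real_asymp
      then have "\<forall>\<^sub>F x in at_top. t / sqrt x \<in> {-pi<..<pi}"
        by (rule topological_tendstoD) auto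
      then have "\<forall>\<^sub>F x in at_top. exp (- x * (1 - cos (t / sqrt x))) = ?s x t"
        by eventually_elim auto
      with c show ?thesis by (rule Lim_transform_eventually)
    qed
    then show "AE t in lborel. ((\<lambda>x. ?s x t) \<longlongrightarrow> exp (- t\<^sup>2 / 2)) at_top" by simp
  qed measurable
  moreover have "(\<integral>t. exp (- t\<^sup>2 / 2) \<partial>lborel) = sqrt (2 * pi)"
    using integral_normal_density[of 1 0] by (simp add: normal_density_def)
  ultimately have "((\<lambda>x. (\<integral>t. ?s x t \<partial>lborel) / sqrt (2 * pi)) \<longlongrightarrow> 1) at_top"
    by (auto intro!: tendsto_eq_intros)
  then show ?thesis
    by (rule Lim_transform_eventually)
       (use eventually_gt_at_top[of 0] in eventually_elim, simp add: bessel_I0_scaled_eq)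
qed

text \<open>The remainder h of the overview, that is, the logarithm of \<open>bessel_I0 t\<close>
  divided by its leading term \<open>exp t / sqrt (2 * pi * t)\<close>.\<close>

definition bessel_I0_defect :: "real \<Rightarrow> real" where
  "bessel_I0_defect t = ln (bessel_I0 t) - t + ln (2 * pi * t) / 2"

lemma measurable_bessel_I0_defect [measurable]: "bessel_I0_defect \<in> borel_measurable borel"
  unfolding bessel_I0_defect_def by measurable

text \<open>The defect tends to 0 at infinity and has only a logarithmic singularity at 0. The
  weight \<open>1 / sqrt t\<close> absorbs that singularity, is integrable along the envelopes, and
  carries the factor \<open>sqrt (1 - r\<^sup>2)\<close> that vanishes in the limit.\<close>

lemma bessel_I0_defect_bound:
  assumes \<epsilon>: "\<epsilon> > 0"
  shows "\<exists>C\<ge>0. \<forall>t>0. \<bar>bessel_I0_defect t\<bar> \<le> \<epsilon> + C / sqrt t"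
proof -
  have eq: "bessel_I0_defect t = ln (sqrt (2 * pi * t) * exp (- t) * bessel_I0 t)" if "t > 0" for t
    using that bessel_I0_pos[of t] by (simp add: bessel_I0_defect_def ln_mult ln_sqrt)
  have "((\<lambda>t. ln (sqrt (2 * pi * t) * exp (- t) * bessel_I0 t)) \<longlongrightarrow> ln 1) at_top"
    by (rule tendsto_ln[OF bessel_I0_asymptotics]) simp
  then have "\<forall>\<^sub>F t in at_top. \<bar>ln (sqrt (2 * pi * t) * exp (- t) * bessel_I0 t)\<bar> < \<epsilon>"
    using \<epsilon> by (auto dest: tendstoD[where e = \<epsilon>] simp: dist_real_def)
  then obtain T0 where T0: "\<And>t. t \<ge> T0 \<Longrightarrow> \<bar>ln (sqrt (2 * pi * t) * exp (- t) * bessel_I0 t)\<bar> < \<epsilon>"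
    by (auto simp: eventually_at_top_linorder)
  define T where "T = max T0 1"
  have T: "T > 0" "\<bar>bessel_I0_defect t\<bar> < \<epsilon>" if "t \<ge> T" for t
    using T0[of t] eq[of t] that by (auto simp: T_def)
  have Tpos: "T > 0" by (simp add: T_def)
  \<comment> \<open>For \<open>t < T\<close> the bounded terms \<open>2 * T\<close> and
    \<open>sqrt (2 * pi * T)\<close> are multiplied by \<open>sqrt T / sqrt t >= 1\<close>; the
    final 1 pays for \<open>1 / w <= 1 / sqrt t\<close>.\<close>
  define C where "C = (2 * T + sqrt (2 * pi * T)) * sqrt T + 1"
  have C: "C \<ge> 0" using Tpos by (simp add: C_def)
  have "\<bar>bessel_I0_defect t\<bar> \<le> C / sqrt t" if t: "t > 0" "t < T" for t
  proof -
    have "- \<bar>t\<bar> \<le> ln (bessel_I0 t)"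
      using bessel_I0_ge[of t] bessel_I0_pos[of t] by (simp add: ln_ge_iff)
    moreover have "ln (bessel_I0 t) \<le> \<bar>t\<bar>"
      using bessel_I0_le[of t] bessel_I0_pos[of t] by (metis ln_exp ln_le_cancel_iff exp_gt_zero)
    ultimately have 1: "\<bar>ln (bessel_I0 t) - t\<bar> \<le> 2 * T" using t by linarith
    define w where "w = sqrt (2 * pi * t)"
    have w: "w > 0" using t by (simp add: w_def)
    have "ln w \<le> w" using ln_le_minus_one[OF w] by simp
    moreover have "- ln w \<le> 1 / w"
      using ln_le_minus_one[of "1 / w"] w by (simp add: ln_div)
    moreover have "ln (2 * pi * t) / 2 = ln w" using t by (simp add: w_def ln_sqrt)
    ultimately have 2: "\<bar>ln (2 * pi * t) / 2\<bar> \<le> w + 1 / w"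
      using w by (smt (verit) divide_pos_pos zero_less_one)
    have "w \<le> sqrt (2 * pi * T)" using t by (simp add: w_def)
    moreover have "1 / w \<le> 1 / sqrt t"
    proof (rule divide_left_mono)
      have "1 * t \<le> (2 * pi) * t" using t pi_gt3 by (intro mult_right_mono) auto
      then show "sqrt t \<le> w" unfolding w_def by simp
    qed (use t w in auto)
    moreover have "2 * T + sqrt (2 * pi * T) \<le> (2 * T + sqrt (2 * pi * T)) * sqrt T / sqrt t"
    proof -
      have "sqrt t \<le> sqrt T" using t by simp
      then show ?thesis
        using t Tpos by (simp add: le_divide_eq mult_left_mono)
    qed
    ultimately show ?thesis
      using 1 2 unfolding bessel_I0_defect_def C_def add_divide_distrib by linarith
  qed
  then have "\<bar>bessel_I0_defect t\<bar> \<le> \<epsilon> + C / sqrt t" if "t > 0" for t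
    using T(2)[of t] \<epsilon> C that by (cases "t < T") (smt (verit) real_sqrt_gt_zero divide_nonneg_pos)+
  with C show ?thesis by blast
qed

section \<open>Mean squared difference of the envelopes\<close>

lemma has_bochner_integral_distr_iff:
  fixes f :: "'a \<Rightarrow> real"
  assumes "f \<in> borel_measurable N" "g \<in> measurable M N"
  shows "has_bochner_integral (distr M N g) f x \<longleftrightarrow> has_bochner_integral M (\<lambda>x. f (g x)) x"
  using assms by (simp add: has_bochner_integral_iff integrable_distr_eq integral_distr)

definition second_envelope :: "real \<Rightarrow> complex \<times> complex \<Rightarrow> real" where
  "second_envelope r z = cmod (of_real (r * cmod (fst z)) + of_real (sqrt (1 - r\<^sup>2)) * snd z)"

lemma measurable_second_envelope [measurable]:
  "second_envelope r \<in> borel_measurable (borel \<Otimes>\<^sub>M borel)"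
  unfolding second_envelope_def by measurable

text \<open>The Rayleigh marginal holds for every \<open>r\<close>, so moments, the log moment and
  null sets of the first envelope transfer to the second.\<close>

lemma distr_second_envelope:
  assumes r: "0 < r" "r < 1"
  shows "distr (cgauss 1 \<Otimes>\<^sub>M cgauss 1) borel (second_envelope r) = distr (cgauss 1) borel cmod"
proof (rule measure_eqI)
  interpret G: prob_space "cgauss 1" by (rule prob_space_cgauss) simp
  fix A assume "A \<in> sets (distr (cgauss 1 \<Otimes>\<^sub>M cgauss 1) borel (second_envelope r))"
  then have [measurable]: "A \<in> sets borel" by simp
  have "emeasure (distr (cgauss 1 \<Otimes>\<^sub>M cgauss 1) borel (second_envelope r)) A
      = (\<integral>\<^sup>+z. \<integral>\<^sup>+n. indicator A (second_envelope r (z, n)) \<partial>cgauss 1 \<partial>cgauss 1)"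
    by (subst emeasure_distr_nn_integral) (auto simp: G.nn_integral_fst[symmetric])
  also have "\<dots> = (\<integral>\<^sup>+w. indicator A (cmod w) \<partial>cgauss 1)"
    using nn_integral_second_envelope[OF r, of "indicator A"] by (simp add: second_envelope_def)
  also have "\<dots> = emeasure (distr (cgauss 1) borel cmod) A"
    by (subst emeasure_distr_nn_integral) auto
  finally show "emeasure (distr (cgauss 1 \<Otimes>\<^sub>M cgauss 1) borel (second_envelope r)) A
      = emeasure (distr (cgauss 1) borel cmod) A" .
qed simp

lemma has_bochner_integral_second_envelope:
  fixes \<psi> :: "real \<Rightarrow> real"
  assumes r: "0 < r" "r < 1" and [measurable]: "\<psi> \<in> borel_measurable borel"
    and I: "has_bochner_integral (cgauss 1) (\<lambda>z. \<psi> (cmod z)) I"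
  shows "has_bochner_integral (cgauss 1 \<Otimes>\<^sub>M cgauss 1) (\<lambda>z. \<psi> (second_envelope r z)) I"
proof -
  have "has_bochner_integral (distr (cgauss 1) borel cmod) \<psi> I"
    by (rule has_bochner_integral_distr_iff[THEN iffD2]) (auto intro: I)
  then have "has_bochner_integral (distr (cgauss 1 \<Otimes>\<^sub>M cgauss 1) borel (second_envelope r)) \<psi> I"
    by (simp only: distr_second_envelope[OF r])
  then show ?thesis
    by (rule has_bochner_integral_distr_iff[THEN iffD1, rotated 2]) auto
qed

lemma AE_second_envelope_pos:
  assumes r: "0 < r" "r < 1"
  shows "AE z in cgauss 1 \<Otimes>\<^sub>M cgauss 1. second_envelope r z > 0"
proof -
  have "AE y in distr (cgauss 1) borel cmod. y > 0"
    using AE_cgauss_nonzero[of 1] by (subst AE_distr_iff) auto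
  then have "AE y in distr (cgauss 1 \<Otimes>\<^sub>M cgauss 1) borel (second_envelope r). y > 0"
    by (simp only: distr_second_envelope[OF r])
  then show ?thesis by (subst (asm) AE_distr_iff) auto
qed

lemma distr_cgauss_pair:
  "distr (cgauss 1 \<Otimes>\<^sub>M cgauss 1) borel fst = cgauss 1"
  "distr (cgauss 1 \<Otimes>\<^sub>M cgauss 1) borel snd = cgauss 1"
proof -
  interpret G: prob_space "cgauss 1" by (rule prob_space_cgauss) simp
  interpret GG: pair_prob_space "cgauss 1" "cgauss 1" ..
  have *: "emeasure (cgauss 1) UNIV = 1" using G.emeasure_space_1 by simp
  show "distr (cgauss 1 \<Otimes>\<^sub>M cgauss 1) borel fst = cgauss 1"
  proof (rule measure_eqI)
    fix A assume "A \<in> sets (distr (cgauss 1 \<Otimes>\<^sub>M cgauss 1) borel (fst :: complex \<times> complex \<Rightarrow> complex))"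
    then have [measurable]: "A \<in> sets borel" by simp
    then show "emeasure (distr (cgauss 1 \<Otimes>\<^sub>M cgauss 1) borel fst) A = emeasure (cgauss 1) A"
      by (subst emeasure_distr_nn_integral) (auto simp: G.nn_integral_fst[symmetric] *)
  qed simp
  show "distr (cgauss 1 \<Otimes>\<^sub>M cgauss 1) borel snd = cgauss 1"
  proof (rule measure_eqI)
    fix A assume "A \<in> sets (distr (cgauss 1 \<Otimes>\<^sub>M cgauss 1) borel (snd :: complex \<times> complex \<Rightarrow> complex))"
    then have [measurable]: "A \<in> sets borel" by simp
    then show "emeasure (distr (cgauss 1 \<Otimes>\<^sub>M cgauss 1) borel snd) A = emeasure (cgauss 1) A"
      by (subst emeasure_distr_nn_integral) (auto simp: G.nn_integral_fst[symmetric] *)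
  qed simp
qed

lemma has_bochner_integral_cgauss_fst:
  assumes [measurable]: "f \<in> borel_measurable borel" and I: "has_bochner_integral (cgauss 1) f (I::real)"
  shows "has_bochner_integral (cgauss 1 \<Otimes>\<^sub>M cgauss 1) (\<lambda>z. f (fst z)) I"
proof -
  have "has_bochner_integral (distr (cgauss 1 \<Otimes>\<^sub>M cgauss 1) borel fst) f I"
    using I by (simp only: distr_cgauss_pair)
  then show ?thesis
    by (rule has_bochner_integral_distr_iff[THEN iffD1, rotated 2]) auto
qed

lemma has_bochner_integral_cgauss_snd:
  assumes [measurable]: "f \<in> borel_measurable borel" and I: "has_bochner_integral (cgauss 1) f (I::real)"
  shows "has_bochner_integral (cgauss 1 \<Otimes>\<^sub>M cgauss 1) (\<lambda>z. f (snd z)) I"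
proof -
  have "has_bochner_integral (distr (cgauss 1 \<Otimes>\<^sub>M cgauss 1) borel snd) f I"
    using I by (simp only: distr_cgauss_pair)
  then show ?thesis
    by (rule has_bochner_integral_distr_iff[THEN iffD1, rotated 2]) auto
qed

lemma AE_cgauss_fst_pos: "AE z in cgauss 1 \<Otimes>\<^sub>M cgauss 1. cmod (fst z) > 0"
proof -
  have "AE z in distr (cgauss 1 \<Otimes>\<^sub>M cgauss 1) borel fst. z \<noteq> 0"
    using AE_cgauss_nonzero[of 1] by (simp only: distr_cgauss_pair)
  then show ?thesis by (subst (asm) AE_distr_iff) auto
qed

text \<open>The right-hand side is free of \<open>r\<close> and serves as dominating function. The
  reverse triangle inequality removes the modulus, and
  \<open>(1 - r)\<^sup>2 <= (1 - r) * (1 + r)\<close> bounds both coefficients by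
  \<open>s\<close>.\<close>

lemma envelope_difference_bound:
  assumes r: "0 < r" "r < 1"
  shows "(cmod (fst z) - second_envelope r z)\<^sup>2 / (1 - r\<^sup>2) \<le> 2 * (cmod (fst z))\<^sup>2 + 2 * (cmod (snd z))\<^sup>2"
proof -
  define s where "s = sqrt (1 - r\<^sup>2)"
  have v: "1 - r\<^sup>2 > 0" using r by (simp add: power_less_one_iff)
  then have s: "s > 0" "s\<^sup>2 = 1 - r\<^sup>2" by (simp_all add: s_def)
  have "(1 - r)\<^sup>2 \<le> s\<^sup>2"
    using r unfolding s by (simp add: power2_eq_square algebra_simps mult_left_le_one_le)
  then have rs: "1 - r \<le> s" using s by (simp add: power2_le_imp_le)
  have "\<bar>cmod (fst z) - second_envelope r z\<bar>
      \<le> cmod (of_real (cmod (fst z)) - (of_real (r * cmod (fst z)) + of_real s * snd z))"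
    unfolding second_envelope_def s_def
    using norm_triangle_ineq3[of "of_real (cmod (fst z))" "of_real (r * cmod (fst z)) + of_real (sqrt (1 - r\<^sup>2)) * snd z"]
    by simp
  also have "\<dots> = cmod (of_real ((1 - r) * cmod (fst z)) - of_real s * snd z)"
    by (simp add: algebra_simps)
  also have "\<dots> \<le> (1 - r) * cmod (fst z) + s * cmod (snd z)"
  proof -
    have "cmod (of_real ((1 - r) * cmod (fst z))) = (1 - r) * cmod (fst z)"
      using r by (simp only: norm_of_real) simp
    moreover have "cmod (of_real s * snd z) = s * cmod (snd z)"
      using s by (simp add: norm_mult)
    ultimately show ?thesis
      using norm_triangle_ineq4[of "of_real ((1 - r) * cmod (fst z))" "of_real s * snd z"] by linarith
  qed
  also have "\<dots> \<le> s * (cmod (fst z) + cmod (snd z))"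
    using mult_right_mono[OF rs, of "cmod (fst z)"] by (simp add: algebra_simps)
  finally have "(cmod (fst z) - second_envelope r z)\<^sup>2 \<le> (s * (cmod (fst z) + cmod (snd z)))\<^sup>2"
    by (rule power2_le_iff_abs_le[THEN iffD2, rotated]) (use s in auto)
  also have "\<dots> = (1 - r\<^sup>2) * (cmod (fst z) + cmod (snd z))\<^sup>2"
    by (simp add: power_mult_distrib s)
  also have "\<dots> \<le> (1 - r\<^sup>2) * (2 * (cmod (fst z))\<^sup>2 + 2 * (cmod (snd z))\<^sup>2)"
    using v sum_squares_bound[of "cmod (fst z)" "cmod (snd z)"]
    by (intro mult_left_mono) (auto simp: power2_sum)
  finally show ?thesis
    using v by (simp add: divide_le_eq mult.commute)
qed

text \<open>Multiplying \<open>x - y k\<close> by \<open>x + y k\<close> replaces the modulus by its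
  square, a polynomial from which one factor \<open>s k\<close> splits off. It cancels the
  denominator, and \<open>x + y k\<close> tends to \<open>2 * x > 0\<close>.\<close>

lemma envelope_difference_tendsto:
  assumes r: "\<And>k. 0 < r k" "\<And>k. r k < 1" "r \<longlonglongrightarrow> 1" and z: "fst z \<noteq> 0"
  shows "(\<lambda>k. (cmod (fst z) - second_envelope (r k) z)\<^sup>2 / (1 - (r k)\<^sup>2)) \<longlonglongrightarrow> (Re (snd z))\<^sup>2"
proof -
  define s where "s k = sqrt (1 - (r k)\<^sup>2)" for k
  define x where "x = cmod (fst z)"
  define n where "n = snd z"
  define y where "y k = second_envelope (r k) z" for k
  have x: "x > 0" using z by (simp add: x_def)
  have v: "1 - (r k)\<^sup>2 > 0" for k using r(1,2)[of k] by (simp add: power_less_one_iff)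
  then have s: "s k > 0" "(s k)\<^sup>2 = 1 - (r k)\<^sup>2" for k by (simp_all add: s_def less_imp_le)
  have s0: "s \<longlonglongrightarrow> 0"
  proof -
    have "(\<lambda>k. sqrt (1 - (r k)\<^sup>2)) \<longlonglongrightarrow> sqrt (1 - 1\<^sup>2)"
      by (intro tendsto_intros r(3))
    then show ?thesis by (simp add: s_def[abs_def])
  qed
  have y_eq: "y k = cmod (of_real (r k * x) + of_real (s k) * n)" for k
    by (simp add: y_def second_envelope_def s_def x_def n_def)
  have yx: "y \<longlonglongrightarrow> x"
  proof -
    have "(\<lambda>k. cmod (of_real (r k * x) + of_real (s k) * n)) \<longlonglongrightarrow> cmod (of_real (1 * x) + of_real 0 * n)"
      by (intro tendsto_intros r(3) s0)
    then show ?thesis using x by (simp add: y_eq[abs_def])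
  qed
  have y2: "(y k)\<^sup>2 = (r k * x)\<^sup>2 + 2 * r k * x * s k * Re n + (s k)\<^sup>2 * (cmod n)\<^sup>2" for k
    unfolding y_eq by (simp only: cmod_power2) (simp add: algebra_simps power2_eq_square)
  have "(x - y k)\<^sup>2 / (1 - (r k)\<^sup>2) = ((s k * x\<^sup>2 - 2 * r k * x * Re n - s k * (cmod n)\<^sup>2) / (x + y k))\<^sup>2" for k
  proof -
    have "y k \<ge> 0" by (simp add: y_def second_envelope_def)
    then have pos: "x + y k > 0" using x by simp
    have "(x - y k) * (x + y k) = x\<^sup>2 - (y k)\<^sup>2"
      by (simp add: power2_eq_square algebra_simps)
    also have "\<dots> = x\<^sup>2 * (1 - (r k)\<^sup>2) - 2 * r k * x * s k * Re n - (s k)\<^sup>2 * (cmod n)\<^sup>2"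
      unfolding y2 by (simp add: power_mult_distrib algebra_simps)
    also have "\<dots> = s k * (s k * x\<^sup>2 - 2 * r k * x * Re n - s k * (cmod n)\<^sup>2)"
      unfolding s(2)[symmetric] by (simp add: power2_eq_square algebra_simps)
    finally have "(x - y k) / s k = (s k * x\<^sup>2 - 2 * r k * x * Re n - s k * (cmod n)\<^sup>2) / (x + y k)"
      using pos s(1)[of k] by (simp add: divide_simps mult_ac)
    then show ?thesis
      unfolding s(2)[symmetric] power_divide[symmetric] by simp
  qed
  moreover have "(\<lambda>k. ((s k * x\<^sup>2 - 2 * r k * x * Re n - s k * (cmod n)\<^sup>2) / (x + y k))\<^sup>2)
      \<longlonglongrightarrow> ((0 * x\<^sup>2 - 2 * 1 * x * Re n - 0 * (cmod n)\<^sup>2) / (x + x))\<^sup>2"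
    using x by (intro tendsto_intros s0 r(3) yx) auto
  moreover have "((0 * x\<^sup>2 - 2 * 1 * x * Re n - 0 * (cmod n)\<^sup>2) / (x + x))\<^sup>2 = (Re n)\<^sup>2"
    using x by (simp add: power2_eq_square field_simps)
  ultimately show ?thesis
    unfolding x_def[symmetric] y_def[symmetric] n_def[symmetric] by simp
qed

definition mean_sq_difference :: "real \<Rightarrow> real" where
  "mean_sq_difference r =
     (\<integral>z. (cmod (fst z) - second_envelope r z)\<^sup>2 / (1 - r\<^sup>2) \<partial>(cgauss 1 \<Otimes>\<^sub>M cgauss 1))"

lemma integrable_envelope_bound:
  "integrable (cgauss 1 \<Otimes>\<^sub>M cgauss 1) (\<lambda>z. 2 * (cmod (fst z))\<^sup>2 + 2 * (cmod (snd z))\<^sup>2)"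
  using has_bochner_integral_cgauss_fst[OF _ has_bochner_integral_cgauss_cmod_sq]
    has_bochner_integral_cgauss_snd[OF _ has_bochner_integral_cgauss_cmod_sq]
  by (simp add: has_bochner_integral_iff)

lemma integrable_sq_difference:
  assumes r: "0 < r" "r < 1"
  shows "integrable (cgauss 1 \<Otimes>\<^sub>M cgauss 1) (\<lambda>z. (cmod (fst z) - second_envelope r z)\<^sup>2 / (1 - r\<^sup>2))"
proof (rule Bochner_Integration.integrable_bound[OF integrable_envelope_bound])
  have "1 - r\<^sup>2 > 0" using r by (simp add: power_less_one_iff)
  then show "AE z in cgauss 1 \<Otimes>\<^sub>M cgauss 1. norm ((cmod (fst z) - second_envelope r z)\<^sup>2 / (1 - r\<^sup>2))
      \<le> norm (2 * (cmod (fst z))\<^sup>2 + 2 * (cmod (snd z))\<^sup>2)"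
    using envelope_difference_bound[OF r] by simp
qed simp

lemma mean_sq_difference_tendsto: "(mean_sq_difference \<longlongrightarrow> 1 / 2) (at_left 1)"
proof (rule tendsto_at_left_sequentially[of 0])
  \<comment> \<open>Dominated convergence is applied along sequences, which here stay in the open
    interval from 0 to 1.\<close>
  fix r :: "nat \<Rightarrow> real"
  assume r: "\<And>k. r k < 1" "\<And>k. 0 < r k" "r \<longlonglongrightarrow> 1"
  have "(\<lambda>k. mean_sq_difference (r k)) \<longlonglongrightarrow> (\<integral>z. (Re (snd z))\<^sup>2 \<partial>(cgauss 1 \<Otimes>\<^sub>M cgauss 1))"
    unfolding mean_sq_difference_def
  proof (rule integral_dominated_convergence[OF _ _ integrable_envelope_bound])
    show "AE z in cgauss 1 \<Otimes>\<^sub>M cgauss 1.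
        (\<lambda>k. (cmod (fst z) - second_envelope (r k) z)\<^sup>2 / (1 - (r k)\<^sup>2)) \<longlonglongrightarrow> (Re (snd z))\<^sup>2"
      using AE_cgauss_fst_pos by eventually_elim (auto intro!: envelope_difference_tendsto r)
    show "AE z in cgauss 1 \<Otimes>\<^sub>M cgauss 1. norm ((cmod (fst z) - second_envelope (r k) z)\<^sup>2 / (1 - (r k)\<^sup>2))
      \<le> 2 * (cmod (fst z))\<^sup>2 + 2 * (cmod (snd z))\<^sup>2" for k
    proof -
      have "1 - (r k)\<^sup>2 > 0" using r(1,2)[of k] by (simp add: power_less_one_iff)
      then show ?thesis
        using envelope_difference_bound[OF r(2,1)] by simp
    qed
  qed simp_all
  moreover have "(\<integral>z. (Re (snd z))\<^sup>2 \<partial>(cgauss 1 \<Otimes>\<^sub>M cgauss 1)) = 1 / 2"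
    using has_bochner_integral_cgauss_snd[OF _ has_bochner_integral_cgauss_Re_sq]
    by (simp add: has_bochner_integral_iff)
  ultimately show "(\<lambda>k. mean_sq_difference (r k)) \<longlonglongrightarrow> 1 / 2" by simp
qed simp

section \<open>High-correlation limit\<close>

lemma ln_envelope_density:
  assumes r: "0 < r" "r < 1" and x: "x > 0" and y: "y > 0"
  shows "ln (envelope_density r x y) = - ln (1 - r\<^sup>2) / 2 - ln (4 * pi * r) / 2
    - r * ((x - y)\<^sup>2 / (1 - r\<^sup>2)) + r / (1 + r) * (x\<^sup>2 + y\<^sup>2)
    + bessel_I0_defect (2 * r * x * y / (1 - r\<^sup>2)) - ln x / 2 - ln y / 2"
proof -
  define v where "v = 1 - r\<^sup>2"
  have v: "v > 0" using r by (simp add: v_def power_less_one_iff)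
  define t where "t = 2 * r * x * y / v"
  have t: "t > 0" using r x y v by (simp add: t_def)
  have "ln (envelope_density r x y) = - (r\<^sup>2 * (x\<^sup>2 + y\<^sup>2)) / v + ln (bessel_I0 t) - ln v"
    unfolding envelope_density_def v_def[symmetric] t_def[symmetric]
    using v bessel_I0_pos[of t] by (simp add: ln_div ln_mult)
  moreover have "ln (2 * pi * t) = ln (4 * pi * r) + ln x + ln y - ln v"
  proof -
    have "2 * pi * t = (4 * pi * r) * x * y / v" by (simp add: t_def)
    also have "ln \<dots> = ln ((4 * pi * r) * x * y) - ln v"
      using r x y v by (intro ln_divide_pos) auto
    also have "ln ((4 * pi * r) * x * y) = ln (4 * pi * r) + ln x + ln y"
      using r x y by (simp only: ln_mult_pos mult_pos_pos pi_gt_zero zero_less_numeral)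
    finally show ?thesis .
  qed
  \<comment> \<open>The square is completed with coefficient \<open>r\<close> instead of
    \<open>r\<^sup>2\<close>: the leftover factor \<open>r * (1 - r) / v = r / (1 + r)\<close>
    remains bounded as \<open>r\<close> tends to 1.\<close>
  moreover have "- (r\<^sup>2 * (x\<^sup>2 + y\<^sup>2)) / v + t = - r * ((x - y)\<^sup>2 / v) + r / (1 + r) * (x\<^sup>2 + y\<^sup>2)"
  proof -
    have f: "v = (1 - r) * (1 + r)" by (simp add: v_def power2_eq_square algebra_simps)
    have "1 - r \<noteq> 0" "1 + r \<noteq> 0" using r by auto
    then have e: "r / (1 + r) * (x\<^sup>2 + y\<^sup>2) = (r * (1 - r) * (x\<^sup>2 + y\<^sup>2)) / v"
      unfolding f by (simp add: divide_simps)
    show ?thesis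
      unfolding e t_def using v by (simp add: divide_simps) (simp add: power2_eq_square algebra_simps)
  qed
  ultimately show ?thesis
    unfolding bessel_I0_defect_def v_def[symmetric] t_def[symmetric] by linarith
qed

definition mean_defect :: "real \<Rightarrow> real" where
  "mean_defect r = (\<integral>z. bessel_I0_defect (2 * r * cmod (fst z) * second_envelope r z / (1 - r\<^sup>2))
      \<partial>(cgauss 1 \<Otimes>\<^sub>M cgauss 1))"

text \<open>Both envelopes are Rayleigh, so the mean does not depend on \<open>r\<close> and can
  multiply a factor that tends to 0.\<close>

lemma has_bochner_integral_inverse_envelopes:
  assumes r: "0 < r" "r < 1"
  shows "has_bochner_integral (cgauss 1 \<Otimes>\<^sub>M cgauss 1)
    (\<lambda>z. (1 / cmod (fst z) + 1 / second_envelope r z) / 2) (\<integral>z. 1 / cmod z \<partial>cgauss 1)"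
proof -
  have I: "has_bochner_integral (cgauss 1) (\<lambda>z. 1 / cmod z) (\<integral>z. 1 / cmod z \<partial>cgauss 1)"
    using integrable_cgauss_inverse_cmod by (simp add: has_bochner_integral_iff)
  show ?thesis
    using has_bochner_integral_divide[OF has_bochner_integral_add[OF has_bochner_integral_cgauss_fst[OF _ I]
          has_bochner_integral_second_envelope[OF r, of "\<lambda>y. 1 / y", OF _ I]], of 2]
    by simp
qed

text \<open>The product of the dependent envelopes sits in a square root; the arithmetic-geometric
  mean inequality separates them, so that marginal laws suffice.\<close>

lemma AE_defect_bound:
  assumes r: "0 < r" "r < 1" and C: "C \<ge> 0"
    and bound: "\<And>t. t > 0 \<Longrightarrow> \<bar>bessel_I0_defect t\<bar> \<le> \<epsilon> + C / sqrt t"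
  shows "AE z in cgauss 1 \<Otimes>\<^sub>M cgauss 1.
    \<bar>bessel_I0_defect (2 * r * cmod (fst z) * second_envelope r z / (1 - r\<^sup>2))\<bar>
      \<le> \<epsilon> + C * sqrt ((1 - r\<^sup>2) / (2 * r)) * ((1 / cmod (fst z) + 1 / second_envelope r z) / 2)"
  using AE_cgauss_fst_pos AE_second_envelope_pos[OF r]
proof eventually_elim
  case (elim z)
  define x y v where "x = cmod (fst z)" and "y = second_envelope r z" and "v = 1 - r\<^sup>2"
  have v: "v > 0" using r by (simp add: v_def power_less_one_iff)
  have xy: "x > 0" "y > 0" using elim by (simp_all add: x_def y_def)
  have "1 / sqrt (2 * r * x * y / v) = sqrt (v / (2 * r) * (1 / x * (1 / y)))"
    using r xy v by (simp add: real_sqrt_divide real_sqrt_mult)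
  also have "\<dots> = sqrt (v / (2 * r)) * sqrt (1 / x * (1 / y))"
    by (rule real_sqrt_mult)
  also have "\<dots> \<le> sqrt (v / (2 * r)) * ((1 / x + 1 / y) / 2)"
    using xy r v by (intro mult_left_mono arith_geo_mean_sqrt) auto
  finally have "C * (1 / sqrt (2 * r * x * y / v)) \<le> C * (sqrt (v / (2 * r)) * ((1 / x + 1 / y) / 2))"
    by (rule mult_left_mono[OF _ C])
  then have "C / sqrt (2 * r * x * y / v) \<le> C * sqrt (v / (2 * r)) * ((1 / x + 1 / y) / 2)"
    by (simp only: mult.assoc times_divide_eq_right mult_1_right)
  moreover have "\<bar>bessel_I0_defect (2 * r * x * y / v)\<bar> \<le> \<epsilon> + C / sqrt (2 * r * x * y / v)"
    using r xy v by (intro bound) simp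
  ultimately show ?case
    unfolding x_def[symmetric] y_def[symmetric] v_def[symmetric] by linarith
qed

lemma
  assumes r: "0 < r" "r < 1" and C: "C \<ge> 0" and \<epsilon>: "\<epsilon> \<ge> 0"
    and bound: "\<And>t. t > 0 \<Longrightarrow> \<bar>bessel_I0_defect t\<bar> \<le> \<epsilon> + C / sqrt t"
  shows integrable_defect_aux: "integrable (cgauss 1 \<Otimes>\<^sub>M cgauss 1)
      (\<lambda>z. bessel_I0_defect (2 * r * cmod (fst z) * second_envelope r z / (1 - r\<^sup>2)))" (is ?int)
    and mean_defect_bound: "\<bar>mean_defect r\<bar>
      \<le> \<epsilon> + C * sqrt ((1 - r\<^sup>2) / (2 * r)) * (\<integral>z. 1 / cmod z \<partial>cgauss 1)"
proof -
  interpret G: prob_space "cgauss 1" by (rule prob_space_cgauss) simp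
  interpret GG: pair_prob_space "cgauss 1" "cgauss 1" ..
  let ?B = "\<lambda>z. \<epsilon> + C * sqrt ((1 - r\<^sup>2) / (2 * r)) * ((1 / cmod (fst z) + 1 / second_envelope r z) / 2)"
  have "has_bochner_integral (cgauss 1 \<Otimes>\<^sub>M cgauss 1) (\<lambda>_. \<epsilon>) \<epsilon>"
    using GG.P.prob_space by (auto simp: has_bochner_integral_iff)
  then have B: "has_bochner_integral (cgauss 1 \<Otimes>\<^sub>M cgauss 1) ?B
      (\<epsilon> + C * sqrt ((1 - r\<^sup>2) / (2 * r)) * (\<integral>z. 1 / cmod z \<partial>cgauss 1))"
    by (intro has_bochner_integral_add has_bochner_integral_mult_right has_bochner_integral_inverse_envelopes[OF r])
  then have Bi: "integrable (cgauss 1 \<Otimes>\<^sub>M cgauss 1) ?B"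
    by (rule integrable.intros)
  note AE = AE_defect_bound[OF r C bound]
  have "1 - r\<^sup>2 > 0" using r by (simp add: power_less_one_iff)
  then have Bpos: "?B z \<ge> 0" for z
    using r C \<epsilon> by (intro add_nonneg_nonneg mult_nonneg_nonneg) (auto simp: second_envelope_def)
  show int: ?int
    by (rule Bochner_Integration.integrable_bound[OF Bi])
       (use AE Bpos in \<open>auto elim!: eventually_mono intro: order.trans[OF _ abs_ge_self]\<close>)
  have "\<bar>mean_defect r\<bar>
      \<le> (\<integral>z. \<bar>bessel_I0_defect (2 * r * cmod (fst z) * second_envelope r z / (1 - r\<^sup>2))\<bar> \<partial>(cgauss 1 \<Otimes>\<^sub>M cgauss 1))"
    unfolding mean_defect_def by (rule integral_abs_bound)
  also have "\<dots> \<le> (\<integral>z. ?B z \<partial>(cgauss 1 \<Otimes>\<^sub>M cgauss 1))"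
    by (rule integral_mono_AE[OF integrable_abs[OF int] Bi AE])
  also have "\<dots> = \<epsilon> + C * sqrt ((1 - r\<^sup>2) / (2 * r)) * (\<integral>z. 1 / cmod z \<partial>cgauss 1)"
    by (rule has_bochner_integral_integral_eq[OF B])
  finally show "\<bar>mean_defect r\<bar> \<le> \<dots>" .
qed

lemma integrable_defect:
  assumes r: "0 < r" "r < 1"
  shows "integrable (cgauss 1 \<Otimes>\<^sub>M cgauss 1)
      (\<lambda>z. bessel_I0_defect (2 * r * cmod (fst z) * second_envelope r z / (1 - r\<^sup>2)))"
proof -
  obtain C where "C \<ge> 0" "\<And>t. t > 0 \<Longrightarrow> \<bar>bessel_I0_defect t\<bar> \<le> 1 + C / sqrt t"
    using bessel_I0_defect_bound[of 1] by auto
  then show ?thesis by (intro integrable_defect_aux[OF r, of C 1]) auto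
qed

lemma eventually_at_left_1: "\<forall>\<^sub>F r in at_left 1. 0 < r \<and> r < (1::real)"
  using eventually_at_left_real[of 0 "1::real"] by simp

lemma mean_defect_tendsto: "(mean_defect \<longlongrightarrow> 0) (at_left 1)"
proof (rule tendstoI)
  fix e :: real assume e: "e > 0"
  then obtain C where C: "C \<ge> 0" "\<And>t. t > 0 \<Longrightarrow> \<bar>bessel_I0_defect t\<bar> \<le> e / 2 + C / sqrt t"
    using bessel_I0_defect_bound[of "e / 2"] by auto
  define K where "K = (\<integral>z. 1 / cmod z \<partial>cgauss 1)"
  have "((\<lambda>r. C * sqrt ((1 - r\<^sup>2) / (2 * r)) * K) \<longlongrightarrow> C * sqrt ((1 - 1\<^sup>2) / (2 * 1)) * K) (at_left 1)"
    by (intro tendsto_intros) auto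
  then have "((\<lambda>r. C * sqrt ((1 - r\<^sup>2) / (2 * r)) * K) \<longlongrightarrow> 0) (at_left 1)" by simp
  then have "\<forall>\<^sub>F r in at_left 1. C * sqrt ((1 - r\<^sup>2) / (2 * r)) * K < e / 2"
    by (rule order_tendstoD) (use e in simp)
  with eventually_at_left_1 show "\<forall>\<^sub>F r in at_left 1. dist (mean_defect r) 0 < e"
  proof eventually_elim
    case (elim r)
    then show ?case
      using mean_defect_bound[of r C "e / 2", OF _ _ C(1) _ C(2)] e unfolding K_def[symmetric] by simp
  qed
qed

lemma envelope_MI_eq:
  assumes r: "0 < r" "r < 1"
  shows "envelope_MI r = (- ln (1 - r\<^sup>2) / 2 - ln (4 * pi * r) / 2 - r * mean_sq_difference r
    + r / (1 + r) * 2 + mean_defect r + euler_mascheroni / 2) / ln 2"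
proof -
  interpret G: prob_space "cgauss 1" by (rule prob_space_cgauss) simp
  interpret GG: pair_prob_space "cgauss 1" "cgauss 1" ..
  let ?GG = "cgauss 1 \<Otimes>\<^sub>M cgauss 1" and ?x = "\<lambda>z :: complex \<times> complex. cmod (fst z)"
  let ?y = "second_envelope r"
  let ?c = "- ln (1 - r\<^sup>2) / 2 - ln (4 * pi * r) / 2"
  let ?F = "\<lambda>z. ?c - r * ((?x z - ?y z)\<^sup>2 / (1 - r\<^sup>2)) + r / (1 + r) * ((?x z)\<^sup>2 + (?y z)\<^sup>2)
    + bessel_I0_defect (2 * r * ?x z * ?y z / (1 - r\<^sup>2)) - ln (?x z) / 2 - ln (?y z) / 2"
  have c: "has_bochner_integral ?GG (\<lambda>_. ?c) ?c"
    using GG.P.prob_space by (auto simp: has_bochner_integral_iff)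
  have msd: "has_bochner_integral ?GG (\<lambda>z. (?x z - ?y z)\<^sup>2 / (1 - r\<^sup>2)) (mean_sq_difference r)"
    using integrable_sq_difference[OF r] by (simp add: has_bochner_integral_iff mean_sq_difference_def)
  have md: "has_bochner_integral ?GG (\<lambda>z. bessel_I0_defect (2 * r * ?x z * ?y z / (1 - r\<^sup>2))) (mean_defect r)"
    using integrable_defect[OF r] by (simp add: has_bochner_integral_iff mean_defect_def)
  have x2: "has_bochner_integral ?GG (\<lambda>z. (?x z)\<^sup>2) 1"
    by (rule has_bochner_integral_cgauss_fst[OF _ has_bochner_integral_cgauss_cmod_sq]) simp
  have y2: "has_bochner_integral ?GG (\<lambda>z. (?y z)\<^sup>2) 1"
    by (rule has_bochner_integral_second_envelope[OF r _ has_bochner_integral_cgauss_cmod_sq]) simp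
  have lx: "has_bochner_integral ?GG (\<lambda>z. ln (?x z)) (- euler_mascheroni / 2)"
    by (rule has_bochner_integral_cgauss_fst[OF _ has_bochner_integral_cgauss_ln]) simp
  have ly: "has_bochner_integral ?GG (\<lambda>z. ln (?y z)) (- euler_mascheroni / 2)"
    by (rule has_bochner_integral_second_envelope[OF r _ has_bochner_integral_cgauss_ln]) simp
  \<comment> \<open>Each envelope contributes 1 to the second moments and a quarter of the
    Euler-Mascheroni constant through its logarithm.\<close>
  have "has_bochner_integral ?GG ?F (?c - r * mean_sq_difference r + r / (1 + r) * (1 + 1) + mean_defect r
      - (- euler_mascheroni / 2) / 2 - (- euler_mascheroni / 2) / 2)"
    by (intro has_bochner_integral_add has_bochner_integral_diff has_bochner_integral_mult_right
        has_bochner_integral_divide c msd md x2 y2 lx ly)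
  then have "(\<integral>z. ?F z \<partial>?GG) = ?c - r * mean_sq_difference r + r / (1 + r) * 2 + mean_defect r + euler_mascheroni / 2"
    by (simp add: has_bochner_integral_iff)
  moreover have "(\<integral>z. ln (envelope_density r (?x z) (?y z)) \<partial>?GG) = (\<integral>z. ?F z \<partial>?GG)"
  proof (rule integral_cong_AE)
    show "AE z in ?GG. ln (envelope_density r (?x z) (?y z)) = ?F z"
      using AE_cgauss_fst_pos AE_second_envelope_pos[OF r]
      by eventually_elim (rule ln_envelope_density[OF r])
  qed measurable
  moreover have "envelope_MI r = (\<integral>z. ln (envelope_density r (?x z) (?y z)) \<partial>?GG) / ln 2"
    by (simp add: envelope_MI_def second_envelope_def log_def)
  ultimately show ?thesis by simp
qed

lemma chi_const_eq: "chi_const = (ln (4 * pi) - 1 - euler_mascheroni) / (2 * ln 2)"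
  by (simp add: chi_const_def log_def ln_div)

text \<open>The constant in nats: \<open>- ln (4 * pi) / 2\<close> from the Bessel asymptotics,
  \<open>- 1/2\<close> from the mean squared difference, \<open>+ 1\<close> from the second moments,
  and half the Euler-Mascheroni constant from the log moments.\<close>

lemma envelope_MI_tendsto:
  "((\<lambda>r. envelope_MI r + log 2 (1 - r\<^sup>2) / 2) \<longlongrightarrow> - chi_const) (at_left 1)"
proof -
  have "((\<lambda>r::real. (- ln (4 * pi * r) / 2 - r * mean_sq_difference r + r / (1 + r) * 2 + mean_defect r
      + euler_mascheroni / 2) / ln 2)
    \<longlongrightarrow> (- ln (4 * pi * 1) / 2 - 1 * (1 / 2) + 1 / (1 + 1) * 2 + 0 + euler_mascheroni / 2) / ln 2) (at_left 1)"
    by (intro tendsto_intros mean_sq_difference_tendsto mean_defect_tendsto) auto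
  moreover have "(- ln (4 * pi * 1) / 2 - 1 * (1 / 2) + 1 / (1 + 1) * 2 + 0 + euler_mascheroni / 2) / ln 2 = - chi_const"
    by (simp add: chi_const_eq field_simps)
  moreover have "\<forall>\<^sub>F r in at_left 1. (- ln (4 * pi * r) / 2 - r * mean_sq_difference r + r / (1 + r) * 2 + mean_defect r
      + euler_mascheroni / 2) / ln 2 = envelope_MI r + log 2 (1 - r\<^sup>2) / 2"
    using eventually_at_left_1
  proof eventually_elim
    case (elim r)
    then show ?case
      by (simp add: envelope_MI_eq log_def add_divide_distrib diff_divide_distrib)
  qed
  ultimately show ?thesis using Lim_transform_eventually by force
qed

text \<open>Here \<open>W = p / D * (1 - r\<^sup>2)\<close> equals
  \<open>p\<^sup>2 / a * (1 + b * s\<^sup>2 / (p * D))\<close>, and both factors are near 1 for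
  small \<open>s\<close> whatever \<open>q\<close> is. This uniformity permits the joint
  limit.\<close>

lemma correlation_ratio_bound:
  fixes p b s q :: real
  assumes p: "p > 0" and b: "b > 0" and s: "s > 0" and q: "0 \<le> q" "q < 1"
  defines "r \<equiv> p * q / sqrt ((p + s) * (p + b * s))"
  defines "D \<equiv> p * (1 - q\<^sup>2) + s + b * s"
  shows "r < 1" "1 - r \<le> (1 - q) + (1 + b) * s / p"
    "\<bar>ln (p / D) + ln (1 - r\<^sup>2)\<bar> \<le> (1 + b) * s / p"
proof -
  define a where "a = (p + s) * (p + b * s)"
  have bs: "b * s > 0" using b s by simp
  have a: "a > 0" "p\<^sup>2 < a" using p s bs by (auto simp: a_def power2_eq_square intro!: mult_strict_mono)
  have q2: "q\<^sup>2 < 1" using q by (simp add: power_less_one_iff)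
  have D: "D \<ge> s + b * s" "D > 0"
    using p q2 s bs unfolding D_def by (auto intro!: add_pos_pos mult_nonneg_nonneg)
  have r2: "r\<^sup>2 = p\<^sup>2 * q\<^sup>2 / a"
    using a unfolding r_def a_def[symmetric] by (simp add: power_divide power_mult_distrib)
  have r0: "r \<ge> 0" using p q a unfolding r_def a_def[symmetric] by simp
  have one_r2: "1 - r\<^sup>2 = (p * D + b * s\<^sup>2) / a"
    \<comment> \<open>The numerator is \<open>a - p\<^sup>2 * q\<^sup>2\<close>; expanding
      \<open>a\<close> leaves \<open>p * D\<close> and the product of the noise variances.\<close>
    using a unfolding r2 by (simp add: divide_simps) (simp add: D_def a_def power2_eq_square algebra_simps)
  then have pos: "1 - r\<^sup>2 > 0" using p D b s a by (simp add: add_pos_pos)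
  then show "r < 1" using r0 by (metis abs_square_less_1 abs_of_nonneg diff_gt_0_iff_gt)
  show "1 - r \<le> (1 - q) + (1 + b) * s / p"
  proof -
    define y where "y = p / sqrt a"
    have y1: "y \<le> 1"
    proof -
      have "p \<le> sqrt a" using a(2) by (intro real_le_rsqrt) simp
      then show ?thesis using a by (simp add: y_def)
    qed
    have "sqrt a \<le> p + (1 + b) * s"
      using p b s bs unfolding a_def
      by (intro real_le_lsqrt) (auto simp: power2_eq_square algebra_simps)
    then have "p / (p + (1 + b) * s) \<le> y"
      using p a s bs unfolding y_def by (intro divide_left_mono) (auto intro!: mult_pos_pos add_pos_pos b)
    moreover have "1 - (1 + b) * s / p \<le> p / (p + (1 + b) * s)"
    proof -
      define d where "d = (1 + b) * s"
      have "d > 0" using b s by (simp add: d_def)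
      then have "(p - d) * (p + d) \<le> p * p" by (simp add: algebra_simps)
      then have "(p - d) / p \<le> p / (p + d)" using p \<open>d > 0\<close> by (simp add: divide_simps)
      then show ?thesis using p by (simp add: d_def diff_divide_distrib)
    qed
    \<comment> \<open>Expanded, this reads \<open>1 - q * y <= (1 - q) + (1 - y)\<close>.\<close>
    moreover have "(1 - q) * (1 - y) \<ge> 0" using q y1 by simp
    moreover have "r = q * y" unfolding r_def y_def a_def by simp
    ultimately show ?thesis by (simp add: algebra_simps)
  qed
  define W where "W = p / D * (1 - r\<^sup>2)"
  have W: "W > 0" "ln W = ln (p / D) + ln (1 - r\<^sup>2)"
    unfolding W_def using p D pos by (simp, intro ln_mult_pos) auto
  have W_eq: "W = p\<^sup>2 / a * (1 + b * s\<^sup>2 / (p * D))"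
    unfolding W_def one_r2 using p D a by (simp add: divide_simps) (simp add: power2_eq_square algebra_simps)
  have "b * s\<^sup>2 / (p * D) \<le> s / p"
  proof -
    have "b * s \<le> D" using D s by simp
    then have "s * (b * s) \<le> s * D" using s by simp
    then show ?thesis using p D by (simp add: divide_simps power2_eq_square mult_ac)
  qed
  moreover have "p\<^sup>2 / a \<le> 1" using a by simp
  moreover have "0 \<le> b * s\<^sup>2 / (p * D)" using b p D by simp
  ultimately have "W \<le> 1 * (1 + s / p)"
    unfolding W_eq by (intro mult_mono) auto
  then have "ln W \<le> ln (1 + s / p)" using W(1) by simp
  also have "\<dots> \<le> s / p" using p s by (intro ln_add_one_self_le_self) simp
  also have "\<dots> \<le> (1 + b) * s / p" using p bs by (simp add: divide_right_mono algebra_simps)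
  finally have up: "ln W \<le> (1 + b) * s / p" .
  have "ln (a / p\<^sup>2) = ln ((1 + s / p) * (1 + b * s / p))"
    using p by (simp add: a_def divide_simps power2_eq_square)
  also have "\<dots> = ln (1 + s / p) + ln (1 + b * s / p)"
    using p s bs by (intro ln_mult_pos) (auto intro!: add_pos_pos divide_pos_pos)
  also have "\<dots> \<le> s / p + b * s / p"
    using p s bs by (intro add_mono ln_add_one_self_le_self) auto
  also have "\<dots> = (1 + b) * s / p" by (simp add: add_divide_distrib algebra_simps)
  finally have "- ((1 + b) * s / p) \<le> ln (p\<^sup>2 / a)"
    using p a by (simp add: ln_div)
  also have "\<dots> \<le> ln W"
  proof -
    have "p\<^sup>2 / a * 1 \<le> W"
      unfolding W_eq using a \<open>0 \<le> b * s\<^sup>2 / (p * D)\<close> by (intro mult_left_mono) auto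
    then show ?thesis using p a W(1) by simp
  qed
  finally show "\<bar>ln (p / D) + ln (1 - r\<^sup>2)\<bar> \<le> (1 + b) * s / p"
    using up W by simp
qed

lemma envelope_MI_limit:
  fixes p b \<epsilon> :: real
  assumes p: "p > 0" and b: "b > 0" and \<epsilon>: "\<epsilon> > 0"
  obtains \<delta> where "\<delta> > 0" "\<delta> \<le> 1" "\<And>q s. q < 1 \<Longrightarrow> 1 - q < \<delta> \<Longrightarrow> 0 < s \<Longrightarrow> s < \<delta> \<Longrightarrow>
    \<bar>envelope_MI (p * q / sqrt ((p + s) * (p + b * s)))
      - (1/2 * log 2 (p / (p * (1 - q\<^sup>2) + s + b * s)) - chi_const)\<bar> < \<epsilon>"
proof -
  have "\<forall>\<^sub>F r in at_left 1. dist (envelope_MI r + log 2 (1 - r\<^sup>2) / 2) (- chi_const) < \<epsilon> / 2"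
    using envelope_MI_tendsto \<epsilon> by (intro tendstoD) auto
  then obtain r0 where r0: "r0 < 1"
      "\<And>r. r0 < r \<Longrightarrow> r < 1 \<Longrightarrow> \<bar>envelope_MI r + log 2 (1 - r\<^sup>2) / 2 + chi_const\<bar> < \<epsilon> / 2"
    unfolding eventually_at_left_field dist_real_def by auto
  define c where "c = 1 + (1 + b) / p"
  have c: "c > 0" using p b by (simp add: c_def add_pos_pos)
  \<comment> \<open>The bound 1 keeps \<open>q\<close> nonnegative, the second term forces
    \<open>r0 < r\<close> through \<open>1 - r < \<delta> * c\<close>, and the third makes the
    logarithmic error less than \<open>\<epsilon> * ln 2\<close>.\<close>
  define \<delta> where "\<delta> = min 1 (min ((1 - r0) / c) (\<epsilon> * p * ln 2 / (1 + b)))"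
  have "\<delta> > 0" using r0 c p b \<epsilon> by (simp add: \<delta>_def)
  moreover have "\<delta> \<le> 1" by (simp add: \<delta>_def)
  moreover have "\<bar>envelope_MI (p * q / sqrt ((p + s) * (p + b * s)))
      - (1/2 * log 2 (p / (p * (1 - q\<^sup>2) + s + b * s)) - chi_const)\<bar> < \<epsilon>"
    if q: "q < 1" "1 - q < \<delta>" and s: "0 < s" "s < \<delta>" for q s
  proof -
    define r where "r = p * q / sqrt ((p + s) * (p + b * s))"
    define L where "L = ln (p / (p * (1 - q\<^sup>2) + s + b * s))"
    have q0: "0 \<le> q" using q \<open>\<delta> \<le> 1\<close> by simp
    note bd = correlation_ratio_bound[OF p b s(1) q0 q(1), folded r_def L_def]
    have "(1 - q) + (1 + b) * s / p < \<delta> + (1 + b) * \<delta> / p"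
      using p b q s by (intro add_strict_mono divide_strict_right_mono mult_strict_left_mono) auto
    also have "\<dots> = \<delta> * c" by (simp add: c_def algebra_simps)
    also have "\<dots> \<le> 1 - r0"
    proof -
      have "\<delta> \<le> (1 - r0) / c" by (simp add: \<delta>_def)
      then show ?thesis using c by (simp add: le_divide_eq)
    qed
    finally have "r0 < r" using bd(2) by linarith
    then have 1: "\<bar>envelope_MI r + log 2 (1 - r\<^sup>2) / 2 + chi_const\<bar> < \<epsilon> / 2"
      using r0(2) bd(1) by simp
    have "(1 + b) * s / p < (1 + b) * (\<epsilon> * p * ln 2 / (1 + b)) / p"
      using p b s by (intro divide_strict_right_mono mult_strict_left_mono) (auto simp: \<delta>_def)
    also have "\<dots> = \<epsilon> * ln 2" using p b by simp
    finally have "\<bar>L + ln (1 - r\<^sup>2)\<bar> < \<epsilon> * ln 2" using bd(3) by linarith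
    then have "\<bar>L + ln (1 - r\<^sup>2)\<bar> / ln 2 < \<epsilon>"
      by (simp add: pos_divide_less_eq)
    then have 2: "\<bar>L / ln 2 + log 2 (1 - r\<^sup>2)\<bar> < \<epsilon>"
      by (simp add: log_def add_divide_distrib[symmetric] abs_divide)
    \<comment> \<open>The logarithmic error enters with weight 1/2, so \<open>\<epsilon>\<close>
      itself is a sufficient bound for it.\<close>
    have le: "\<bar>A - B / 2\<bar> < \<epsilon>" if "\<bar>A\<bar> < \<epsilon> / 2" "\<bar>B\<bar> < \<epsilon>" for A B
      using that by linarith
    have "envelope_MI r - (1/2 * (L / ln 2) - chi_const)
        = (envelope_MI r + log 2 (1 - r\<^sup>2) / 2 + chi_const) - (L / ln 2 + log 2 (1 - r\<^sup>2)) / 2"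
      by (simp add: field_simps)
    then have "\<bar>envelope_MI r - (1/2 * (L / ln 2) - chi_const)\<bar> < \<epsilon>"
      using le[OF 1 2] by simp
    then show ?thesis
      unfolding r_def L_def by (simp add: log_def)
  qed
  ultimately show ?thesis by (rule that)
qed

theorem theorem2:
  fixes p b b' :: real
  assumes "p > 0" and "b > 0" and "b' > 0"
  shows
   "(\<forall>sB>0. \<forall>\<epsilon>>0. \<exists>\<delta>>0. \<forall>(\<rho>::complex) sA.
       cmod \<rho> < 1 \<and> 1 - cmod \<rho> < \<delta> \<and> 0 < sA \<and> sA < \<delta> \<longrightarrow>
       (\<forall>(M::'a measure) H HE WA WB WE.
          channel_model M p \<rho> sA sB (b * sA) H HE WA WB WE \<longrightarrow>
          \<bar>MI_bits M (\<lambda>\<omega>. cmod (H \<omega> + WA \<omega>)) (\<lambda>\<omega>. cmod (HE \<omega> + WE \<omega>))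
            - (1/2 * log 2 (p / (p * (1 - (cmod \<rho>)\<^sup>2) + sA + b * sA)) - chi_const)\<bar> < \<epsilon>))
    \<and>
    (\<forall>sA>0. \<forall>\<epsilon>>0. \<exists>\<delta>>0. \<forall>(\<rho>::complex) sB.
       cmod \<rho> < 1 \<and> 1 - cmod \<rho> < \<delta> \<and> 0 < sB \<and> sB < \<delta> \<longrightarrow>
       (\<forall>(M::'a measure) H HE WA WB WE.
          channel_model M p \<rho> sA sB (b' * sB) H HE WA WB WE \<longrightarrow>
          \<bar>MI_bits M (\<lambda>\<omega>. cmod (H \<omega> + WB \<omega>)) (\<lambda>\<omega>. cmod (HE \<omega> + WE \<omega>))
            - (1/2 * log 2 (p / (p * (1 - (cmod \<rho>)\<^sup>2) + sB + b' * sB)) - chi_const)\<bar> < \<epsilon>))"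
proof (intro conjI allI impI)
  fix sB \<epsilon> :: real
  assume sB: "sB > 0" and \<epsilon>: "\<epsilon> > 0"
  obtain \<delta> where \<delta>: "\<delta> > 0" "\<delta> \<le> 1" "\<And>q s. q < 1 \<Longrightarrow> 1 - q < \<delta> \<Longrightarrow> 0 < s \<Longrightarrow> s < \<delta> \<Longrightarrow>
    \<bar>envelope_MI (p * q / sqrt ((p + s) * (p + b * s)))
      - (1/2 * log 2 (p / (p * (1 - q\<^sup>2) + s + b * s)) - chi_const)\<bar> < \<epsilon>"
    using envelope_MI_limit[OF \<open>p > 0\<close> \<open>b > 0\<close> \<epsilon>] by blast
  show "\<exists>\<delta>>0. \<forall>(\<rho>::complex) sA.
       cmod \<rho> < 1 \<and> 1 - cmod \<rho> < \<delta> \<and> 0 < sA \<and> sA < \<delta> \<longrightarrow>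
       (\<forall>(M::'a measure) H HE WA WB WE.
          channel_model M p \<rho> sA sB (b * sA) H HE WA WB WE \<longrightarrow>
          \<bar>MI_bits M (\<lambda>\<omega>. cmod (H \<omega> + WA \<omega>)) (\<lambda>\<omega>. cmod (HE \<omega> + WE \<omega>))
            - (1/2 * log 2 (p / (p * (1 - (cmod \<rho>)\<^sup>2) + sA + b * sA)) - chi_const)\<bar> < \<epsilon>)"
  proof (intro exI[of _ \<delta>] conjI allI impI \<delta>(1), elim conjE)
    fix \<rho> :: complex and sA and M :: "'a measure" and H HE WA WB WE
    assume ch: "channel_model M p \<rho> sA sB (b * sA) H HE WA WB WE"
      and \<rho>: "cmod \<rho> < 1" "1 - cmod \<rho> < \<delta>" and sA: "0 < sA" "sA < \<delta>"
    \<comment> \<open>Since \<open>\<delta> <= 1\<close>, closeness to the unit circle excludes 0,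
      as the reduction to a strictly positive correlation demands.\<close>
    have "\<rho> \<noteq> 0" using \<rho>(2) \<delta>(2) by auto
    then show "\<bar>MI_bits M (\<lambda>\<omega>. cmod (H \<omega> + WA \<omega>)) (\<lambda>\<omega>. cmod (HE \<omega> + WE \<omega>))
            - (1/2 * log 2 (p / (p * (1 - (cmod \<rho>)\<^sup>2) + sA + b * sA)) - chi_const)\<bar> < \<epsilon>"
      using \<delta>(3)[OF \<rho> sA] MI_channel_A[OF ch] assms \<rho> sA sB by simp
  qed
next
  fix sA \<epsilon> :: real
  assume sA: "sA > 0" and \<epsilon>: "\<epsilon> > 0"
  obtain \<delta> where \<delta>: "\<delta> > 0" "\<delta> \<le> 1" "\<And>q s. q < 1 \<Longrightarrow> 1 - q < \<delta> \<Longrightarrow> 0 < s \<Longrightarrow> s < \<delta> \<Longrightarrow>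
    \<bar>envelope_MI (p * q / sqrt ((p + s) * (p + b' * s)))
      - (1/2 * log 2 (p / (p * (1 - q\<^sup>2) + s + b' * s)) - chi_const)\<bar> < \<epsilon>"
    using envelope_MI_limit[OF \<open>p > 0\<close> \<open>b' > 0\<close> \<epsilon>] by blast
  show "\<exists>\<delta>>0. \<forall>(\<rho>::complex) sB.
       cmod \<rho> < 1 \<and> 1 - cmod \<rho> < \<delta> \<and> 0 < sB \<and> sB < \<delta> \<longrightarrow>
       (\<forall>(M::'a measure) H HE WA WB WE.
          channel_model M p \<rho> sA sB (b' * sB) H HE WA WB WE \<longrightarrow>
          \<bar>MI_bits M (\<lambda>\<omega>. cmod (H \<omega> + WB \<omega>)) (\<lambda>\<omega>. cmod (HE \<omega> + WE \<omega>))
            - (1/2 * log 2 (p / (p * (1 - (cmod \<rho>)\<^sup>2) + sB + b' * sB)) - chi_const)\<bar> < \<epsilon>)"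
  proof (intro exI[of _ \<delta>] conjI allI impI \<delta>(1), elim conjE)
    fix \<rho> :: complex and sB and M :: "'a measure" and H HE WA WB WE
    assume ch: "channel_model M p \<rho> sA sB (b' * sB) H HE WA WB WE"
      and \<rho>: "cmod \<rho> < 1" "1 - cmod \<rho> < \<delta>" and sB: "0 < sB" "sB < \<delta>"
    have "\<rho> \<noteq> 0" using \<rho>(2) \<delta>(2) by auto
    then show "\<bar>MI_bits M (\<lambda>\<omega>. cmod (H \<omega> + WB \<omega>)) (\<lambda>\<omega>. cmod (HE \<omega> + WE \<omega>))
            - (1/2 * log 2 (p / (p * (1 - (cmod \<rho>)\<^sup>2) + sB + b' * sB)) - chi_const)\<bar> < \<epsilon>"
      using \<delta>(3)[OF \<rho> sB] MI_channel_B[OF ch] assms \<rho> sA sB by simp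
  qed
qed

end
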